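(* Let $X$ be a Tychonoff space and let $I$ be an ideal in $C(X)$ which is closed under uniform limits. Then the following statements are equivalent: (1) $C_{m^I}(X)$ is completely metrizable. (2) $C_{m^I}(X)$ is Čech-complete. (3) $C_{m^I}(X)$ is hereditarily Baire. (4) $X$ is $I$-pseudocompact. (5) $C_{m^I}(X)$ is locally Čech-complete. (6) $C_{m^I}(X)$ is an open continuous image of a paracompact Čech-complete space. (7) $C_{m^I}(X)$ is an open continuous image of a Čech-complete space.
   Context: $C(X)$ is the ring of all real-valued continuous functions on $X$; ideals may be improper. $I$ is closed under uniform limits if whenever a sequence in $I$ converges uniformly on $X$ to $f\in C(X)$, then $f\in I$. $C_+(X)$ is the set of strictly positive $u\in C(X)$. $Z(g)=\{x\in X:g(x)=0\}$ and $\bigcap Z[I]=\bigcap_{g\in I}Z(g)$. A subset $Y\subseteq X$ is bounded if every $f\in C(X)$ is bounded on $Y$. $X$ is $I$-pseudocompact if $X\setminus\bigcap Z[I]$ is a bounded subset of $X$. The $m^I$-topology on $C(X)$ has as base the sets $B_m(f,I,u)=\{g\in C(X):|f(x)-g(x)|<u(x)\ \forall x\in X,\ f-g\in I\}$, $f\in C(X)$, $u\in C_+(X)$; $C_{m^I}(X)$ is $C(X)$ with this topology. A (Tychonoff) space $Y$ is Čech-complete if it is a $G_\delta$-set in its Stone–Čech compactification $\beta Y$; locally Čech-complete if every point has a Čech-complete neighborhood. A space is hereditarily Baire if every closed subspace is a Baire space. *)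

theory Defs
  imports "HOL-Analysis.Analysis" "HOL-Algebra.Ideal"
begin

definition tychonoff_space :: "'a topology \<Rightarrow> bool"
  where "tychonoff_space X \<longleftrightarrow> completely_regular_space X \<and> Hausdorff_space X"


section \<open>The ring of continuous real-valued functions and the m-topology of an ideal\<close>

text \<open>
  A function on the space \<open>X\<close> is represented by a HOL function that is \<open>undefined\<close> outside
  \<open>topspace X\<close>, so that equality of elements is equality of functions on \<open>X\<close>.
\<close>

definition C_ring :: "'a topology \<Rightarrow> ('a \<Rightarrow> real) ring"
  where "C_ring X =
    \<lparr>carrier = {f \<in> extensional (topspace X). continuous_map X euclideanreal f},
     mult = (\<lambda>f g. \<lambda>x\<in>topspace X. f x * g x),
     one = (\<lambda>x\<in>topspace X. 1),
     zero = (\<lambda>x\<in>topspace X. 0),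
     add = (\<lambda>f g. \<lambda>x\<in>topspace X. f x + g x)\<rparr>"

definition C_pos :: "'a topology \<Rightarrow> ('a \<Rightarrow> real) set"
  where "C_pos X = {u \<in> carrier (C_ring X). \<forall>x\<in>topspace X. 0 < u x}"

definition closed_under_uniform_limits :: "'a topology \<Rightarrow> ('a \<Rightarrow> real) set \<Rightarrow> bool"
  where "closed_under_uniform_limits X I \<longleftrightarrow>
    (\<forall>(s :: nat \<Rightarrow> 'a \<Rightarrow> real) f.
       (\<forall>n. s n \<in> I) \<and> f \<in> carrier (C_ring X) \<and> uniform_limit (topspace X) s f sequentially
       \<longrightarrow> f \<in> I)"

definition zero_set :: "'a topology \<Rightarrow> ('a \<Rightarrow> real) \<Rightarrow> 'a set"
  where "zero_set X g = {x \<in> topspace X. g x = 0}"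

definition bounded_subset :: "'a topology \<Rightarrow> 'a set \<Rightarrow> bool"
  where "bounded_subset X Y \<longleftrightarrow>
    Y \<subseteq> topspace X \<and> (\<forall>f\<in>carrier (C_ring X). bounded (f ` Y))"

definition I_pseudocompact :: "'a topology \<Rightarrow> ('a \<Rightarrow> real) set \<Rightarrow> bool"
  where "I_pseudocompact X I \<longleftrightarrow> bounded_subset X (topspace X - (\<Inter>g\<in>I. zero_set X g))"

definition B_m :: "'a topology \<Rightarrow> ('a \<Rightarrow> real) \<Rightarrow> ('a \<Rightarrow> real) set \<Rightarrow> ('a \<Rightarrow> real) \<Rightarrow> ('a \<Rightarrow> real) set"
  where "B_m X f I u =
    {g \<in> carrier (C_ring X). (\<forall>x\<in>topspace X. \<bar>f x - g x\<bar> < u x) \<and>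
                             (\<lambda>x\<in>topspace X. f x - g x) \<in> I}"

text \<open>
  For an ideal \<open>I\<close> the sets \<open>B_m X f I u\<close> are not only a subbase but a base of this topology;
  see \<open>openin_m_topology\<close> below.
\<close>

definition m_topology :: "'a topology \<Rightarrow> ('a \<Rightarrow> real) set \<Rightarrow> ('a \<Rightarrow> real) topology"
  where "m_topology X I =
    topology_generated_by {B_m X f I u |f u. f \<in> carrier (C_ring X) \<and> u \<in> C_pos X}"


section \<open>Cech-completeness\<close>

text \<open>
  The Stone--Cech compactification of \<open>Y\<close> is the closure of the image of \<open>Y\<close> under the evaluation
  map into the cube with one factor \<open>[0,1]\<close> for each continuous \<open>f : Y \<rightarrow> [0,1]\<close>. For Tychonoff
  \<open>Y\<close> the evaluation map is an embedding, and \<open>Y\<close> is identified with its image.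
\<close>

definition unit_functions :: "'a topology \<Rightarrow> ('a \<Rightarrow> real) set"
  where "unit_functions Y =
    {f \<in> extensional (topspace Y). continuous_map Y (top_of_set {0..1}) f}"

definition evaluation :: "'a topology \<Rightarrow> 'a \<Rightarrow> ('a \<Rightarrow> real) \<Rightarrow> real"
  where "evaluation Y y = (\<lambda>f\<in>unit_functions Y. f y)"

definition unit_cube :: "'a topology \<Rightarrow> (('a \<Rightarrow> real) \<Rightarrow> real) topology"
  where "unit_cube Y = product_topology (\<lambda>f. top_of_set {0..1}) (unit_functions Y)"

definition stone_cech :: "'a topology \<Rightarrow> (('a \<Rightarrow> real) \<Rightarrow> real) topology"
  where "stone_cech Y =
    subtopology (unit_cube Y) (unit_cube Y closure_of (evaluation Y ` topspace Y))"

definition cech_complete_space :: "'a topology \<Rightarrow> bool"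
  where "cech_complete_space Y \<longleftrightarrow>
    tychonoff_space Y \<and> gdelta_in (stone_cech Y) (evaluation Y ` topspace Y)"

text \<open>A neighbourhood of a point need not be open.\<close>

definition locally_cech_complete_space :: "'a topology \<Rightarrow> bool"
  where "locally_cech_complete_space Y \<longleftrightarrow>
    tychonoff_space Y \<and>
    (\<forall>y\<in>topspace Y. \<exists>U N. openin Y U \<and> y \<in> U \<and> U \<subseteq> N \<and> N \<subseteq> topspace Y \<and>
                         cech_complete_space (subtopology Y N))"


section \<open>Baire and paracompact spaces, open continuous images\<close>

definition baire_space :: "'a topology \<Rightarrow> bool"
  where "baire_space Y \<longleftrightarrow>
    (\<forall>U :: nat \<Rightarrow> 'a set.
       (\<forall>n. openin Y (U n) \<and> Y closure_of (U n) = topspace Y)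
       \<longrightarrow> Y closure_of (\<Inter>n. U n) = topspace Y)"

definition hereditarily_baire_space :: "'a topology \<Rightarrow> bool"
  where "hereditarily_baire_space Y \<longleftrightarrow>
    (\<forall>S. closedin Y S \<longrightarrow> baire_space (subtopology Y S))"

definition paracompact_space :: "'a topology \<Rightarrow> bool"
  where "paracompact_space Y \<longleftrightarrow>
    Hausdorff_space Y \<and>
    (\<forall>\<U>. (\<forall>U\<in>\<U>. openin Y U) \<and> \<Union>\<U> = topspace Y \<longrightarrow>
       (\<exists>\<V>. (\<forall>V\<in>\<V>. openin Y V) \<and> \<Union>\<V> = topspace Y \<and>
            (\<forall>V\<in>\<V>. \<exists>U\<in>\<U>. V \<subseteq> U) \<and> locally_finite_in Y \<V>))"

text \<open>
  ``Being an open continuous image of some space with a given property'' quantifies over spaces of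
  every type. In a statement about a space \<open>Z\<close> on type \<open>'z\<close> this is rendered by letting the source
  space range over all topologies on \<open>'z + 'b\<close> with \<open>'b\<close> a free type variable: every space on any
  type \<open>'b\<close> is covered via \<open>Inr\<close>, and the type is never too small to contain \<open>Z\<close> itself.
\<close>

definition open_continuous_image_via :: "'a topology \<Rightarrow> 'b topology \<Rightarrow> ('a \<Rightarrow> 'b) \<Rightarrow> bool"
  where "open_continuous_image_via Y Z q \<longleftrightarrow>
    continuous_map Y Z q \<and> open_map Y Z q \<and> q ` topspace Y = topspace Z"


section \<open>Consistency of the encodings\<close>

lemma carrier_C_ring_iff:
  "f \<in> carrier (C_ring X) \<longleftrightarrow> f \<in> extensional (topspace X) \<and> continuous_map X euclideanreal f"
  by (simp add: C_ring_def)

lemma restrict_in_C_ring: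
  assumes "continuous_map X euclideanreal f"
  shows "(\<lambda>x\<in>topspace X. f x) \<in> carrier (C_ring X)"
  unfolding carrier_C_ring_iff
  using continuous_map_eq [OF assms, of "\<lambda>x\<in>topspace X. f x"] by simp

lemma cring_C_ring: "cring (C_ring X)"
proof (rule cringI)
  show "abelian_group (C_ring X)"
  proof (rule abelian_groupI)
    fix f assume f: "f \<in> carrier (C_ring X)"
    then have "(\<lambda>x\<in>topspace X. - f x) \<in> carrier (C_ring X)"
      by (intro restrict_in_C_ring continuous_map_minus) (simp add: carrier_C_ring_iff)
    then show "\<exists>g\<in>carrier (C_ring X). g \<oplus>\<^bsub>C_ring X\<^esub> f = \<zero>\<^bsub>C_ring X\<^esub>"
      by (rule bexI [rotated]) (auto simp: C_ring_def)
    show "\<zero>\<^bsub>C_ring X\<^esub> \<oplus>\<^bsub>C_ring X\<^esub> f = f"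
      using f by (auto simp: C_ring_def extensional_def restrict_def)
  next
    fix f g assume "f \<in> carrier (C_ring X)" "g \<in> carrier (C_ring X)"
    then have "(\<lambda>x\<in>topspace X. f x + g x) \<in> carrier (C_ring X)"
      by (intro restrict_in_C_ring continuous_map_add) (simp_all add: carrier_C_ring_iff)
    then show "f \<oplus>\<^bsub>C_ring X\<^esub> g \<in> carrier (C_ring X)"
      by (simp add: C_ring_def)
  next
    have "(\<lambda>x\<in>topspace X. 0) \<in> carrier (C_ring X)"
      by (intro restrict_in_C_ring) simp
    then show "\<zero>\<^bsub>C_ring X\<^esub> \<in> carrier (C_ring X)"
      by (simp add: C_ring_def)
  qed (simp_all add: C_ring_def restrict_def fun_eq_iff algebra_simps)
next
  show "comm_monoid (C_ring X)"
  proof (rule comm_monoidI)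
    fix f g assume "f \<in> carrier (C_ring X)" "g \<in> carrier (C_ring X)"
    then have "(\<lambda>x\<in>topspace X. f x * g x) \<in> carrier (C_ring X)"
      by (intro restrict_in_C_ring continuous_map_real_mult) (simp_all add: carrier_C_ring_iff)
    then show "f \<otimes>\<^bsub>C_ring X\<^esub> g \<in> carrier (C_ring X)"
      by (simp add: C_ring_def)
  next
    have "(\<lambda>x\<in>topspace X. 1) \<in> carrier (C_ring X)"
      by (intro restrict_in_C_ring) simp
    then show "\<one>\<^bsub>C_ring X\<^esub> \<in> carrier (C_ring X)"
      by (simp add: C_ring_def)
  next
    fix f assume "f \<in> carrier (C_ring X)"
    then show "\<one>\<^bsub>C_ring X\<^esub> \<otimes>\<^bsub>C_ring X\<^esub> f = f"
      by (auto simp: C_ring_def extensional_def restrict_def)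
  qed (simp_all add: C_ring_def restrict_def fun_eq_iff algebra_simps)
qed (simp_all add: C_ring_def restrict_def fun_eq_iff algebra_simps)

lemma B_m_refine:
  assumes I: "ideal I (C_ring X)"
    and f: "f \<in> carrier (C_ring X)" and u: "u \<in> C_pos X" and g: "g \<in> B_m X f I u"
  shows "\<exists>v\<in>C_pos X. B_m X g I v \<subseteq> B_m X f I u"
proof
  let ?v = "\<lambda>x\<in>topspace X. u x - \<bar>f x - g x\<bar>"
  have "continuous_map X euclideanreal (\<lambda>x. u x - \<bar>f x - g x\<bar>)"
    using f u g
    by (intro continuous_map_diff continuous_map_real_abs)
       (auto simp: C_pos_def B_m_def carrier_C_ring_iff)
  from restrict_in_C_ring [OF this] show "?v \<in> C_pos X"
    using g by (auto simp: C_pos_def B_m_def)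
  show "B_m X g I ?v \<subseteq> B_m X f I u"
  proof
    fix h assume h: "h \<in> B_m X g I ?v"
    have "(\<lambda>x\<in>topspace X. f x - g x) \<oplus>\<^bsub>C_ring X\<^esub> (\<lambda>x\<in>topspace X. g x - h x) \<in> I"
      using g h I by (intro additive_subgroup.a_closed [OF ideal.axioms(1)]) (auto simp: B_m_def)
    moreover have "(\<lambda>x\<in>topspace X. f x - g x) \<oplus>\<^bsub>C_ring X\<^esub> (\<lambda>x\<in>topspace X. g x - h x)
        = (\<lambda>x\<in>topspace X. f x - h x)"
      by (auto simp: C_ring_def)
    moreover have "\<bar>f x - h x\<bar> < u x" if "x \<in> topspace X" for x
    proof -
      have "\<bar>g x - h x\<bar> < u x - \<bar>f x - g x\<bar>"
        using h that by (auto simp: B_m_def)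
      then show ?thesis by linarith
    qed
    ultimately show "h \<in> B_m X f I u"
      using h by (auto simp: B_m_def)
  qed
qed

lemma B_m_self:
  assumes "ideal I (C_ring X)" "f \<in> carrier (C_ring X)" "u \<in> C_pos X"
  shows "f \<in> B_m X f I u"
proof -
  have "\<zero>\<^bsub>C_ring X\<^esub> \<in> I"
    using assms(1) by (simp add: additive_subgroup.zero_closed ideal.axioms(1))
  then show ?thesis
    using assms by (simp add: B_m_def C_pos_def C_ring_def)
qed

lemma B_m_mono: "(\<And>x. x \<in> topspace X \<Longrightarrow> u x \<le> v x) \<Longrightarrow> B_m X f I u \<subseteq> B_m X f I v"
  unfolding B_m_def by (auto intro: order_less_le_trans)

lemma openin_m_topology_iff:
  assumes I: "ideal I (C_ring X)"
  shows "openin (m_topology X I) S \<longleftrightarrow>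
    S \<subseteq> carrier (C_ring X) \<and> (\<forall>f\<in>S. \<exists>u\<in>C_pos X. B_m X f I u \<subseteq> S)"
    (is "_ \<longleftrightarrow> ?P S")
proof
  assume "openin (m_topology X I) S"
  then have "generate_topology_on {B_m X f I u |f u. f \<in> carrier (C_ring X) \<and> u \<in> C_pos X} S"
    by (simp add: m_topology_def openin_topology_generated_by_iff)
  then show "?P S"
  proof induction
    case Empty
    show ?case by simp
  next
    case (Int a b)
    show ?case
    proof (intro conjI ballI)
      show "a \<inter> b \<subseteq> carrier (C_ring X)"
        using Int.IH(1) by (simp add: le_infI1)
      fix f assume f: "f \<in> a \<inter> b"
      obtain u where u: "u \<in> C_pos X" "B_m X f I u \<subseteq> a"
        using Int.IH(1) f by (elim conjE) (drule bspec [where x=f], auto)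
      obtain v where v: "v \<in> C_pos X" "B_m X f I v \<subseteq> b"
        using Int.IH(2) f by (elim conjE) (drule bspec [where x=f], auto)
      let ?w = "\<lambda>x\<in>topspace X. min (u x) (v x)"
      have "continuous_map X euclideanreal (\<lambda>x. min (u x) (v x))"
        using u(1) v(1)
        by (intro continuous_map_real_min) (simp_all add: C_pos_def carrier_C_ring_iff)
      from restrict_in_C_ring [OF this]
      have w: "?w \<in> C_pos X"
        using u(1) v(1) by (simp add: C_pos_def)
      have "B_m X f I ?w \<subseteq> B_m X f I u" "B_m X f I ?w \<subseteq> B_m X f I v"
        by (rule B_m_mono, simp)+
      with u(2) v(2) have "B_m X f I ?w \<subseteq> a \<inter> b"
        by (meson Int_greatest order_trans)
      with w show "\<exists>u\<in>C_pos X. B_m X f I u \<subseteq> a \<inter> b"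
        by (intro bexI [of _ ?w])
    qed
  next
    case (UN K)
    show ?case
    proof (intro conjI ballI)
      show "\<Union>K \<subseteq> carrier (C_ring X)"
        using UN.IH by (simp add: Sup_le_iff)
      fix f assume "f \<in> \<Union>K"
      then obtain k where k: "k \<in> K" "f \<in> k" ..
      obtain u where u: "u \<in> C_pos X" "B_m X f I u \<subseteq> k"
        using bspec [OF conjunct2 [OF UN.IH [OF k(1)]] k(2)] by (elim bexE)
      from u(2) k(1) have "B_m X f I u \<subseteq> \<Union>K"
        by (rule order_trans [OF _ Union_upper])
      with u(1) show "\<exists>u\<in>C_pos X. B_m X f I u \<subseteq> \<Union>K"
        by (intro bexI [of _ u])
    qed
  next
    case (Basis s)
    then obtain f u where s: "s = B_m X f I u" and f: "f \<in> carrier (C_ring X)" and u: "u \<in> C_pos X"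
      by (elim CollectE exE conjE)
    have "s \<subseteq> carrier (C_ring X)"
      unfolding s B_m_def by (rule Collect_restrict)
    moreover have "\<forall>g\<in>s. \<exists>v\<in>C_pos X. B_m X g I v \<subseteq> s"
      unfolding s by (intro ballI B_m_refine [OF I f u])
    ultimately show ?case ..
  qed
next
  assume P: "?P S"
  show "openin (m_topology X I) S"
  proof (subst openin_subopen, intro ballI)
    fix f assume fS: "f \<in> S"
    obtain u where u: "u \<in> C_pos X" "B_m X f I u \<subseteq> S"
      using bspec [OF conjunct2 [OF P] fS] by (elim bexE)
    have f: "f \<in> carrier (C_ring X)"
      using conjunct1 [OF P] fS by (rule subsetD)
    have "openin (m_topology X I) (B_m X f I u)"
      unfolding m_topology_def
      by (rule topology_generated_by_Basis, intro CollectI exI [of _ f] exI [of _ u] conjI refl f u(1))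
    with B_m_self [OF I f u(1)] u(2)
    show "\<exists>T. openin (m_topology X I) T \<and> f \<in> T \<and> T \<subseteq> S"
      by (intro exI [of _ "B_m X f I u"] conjI)
  qed
qed

lemma openin_m_topology:
  assumes I: "ideal I (C_ring X)"
  shows "openin (m_topology X I) =
    arbitrary union_of (\<lambda>B. B \<in> {B_m X f I u |f u. f \<in> carrier (C_ring X) \<and> u \<in> C_pos X})"
    (is "_ = arbitrary union_of ?B")
  unfolding openin_topology_base_unique
proof (intro conjI allI impI)
  fix B assume "?B B"
  then show "openin (m_topology X I) B"
    unfolding m_topology_def by (rule topology_generated_by_Basis)
next
  fix S f assume "openin (m_topology X I) S \<and> f \<in> S"
  then have S: "S \<subseteq> carrier (C_ring X) \<and> (\<forall>f\<in>S. \<exists>u\<in>C_pos X. B_m X f I u \<subseteq> S)" and fS: "f \<in> S"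
    by (simp_all add: openin_m_topology_iff [OF I])
  obtain u where u: "u \<in> C_pos X" "B_m X f I u \<subseteq> S"
    using bspec [OF conjunct2 [OF S] fS] by (elim bexE)
  have f: "f \<in> carrier (C_ring X)"
    using conjunct1 [OF S] fS by (rule subsetD)
  show "\<exists>B. ?B B \<and> f \<in> B \<and> B \<subseteq> S"
    by (intro exI [of _ "B_m X f I u"] conjI CollectI exI [of _ f] exI [of _ u] refl f u
        B_m_self [OF I f u(1)])
qed

lemma topspace_m_topology:
  assumes I: "ideal I (C_ring X)"
  shows "topspace (m_topology X I) = carrier (C_ring X)"
proof -
  have "(\<lambda>x\<in>topspace X. 1) \<in> C_pos X"
    using restrict_in_C_ring [of X "\<lambda>x. 1"] by (auto simp: C_pos_def)
  then have "openin (m_topology X I) (carrier (C_ring X))"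
    using openin_m_topology_iff [OF I] by (auto simp: B_m_def)
  moreover have "topspace (m_topology X I) \<subseteq> carrier (C_ring X)"
    using openin_m_topology_iff [OF I, of "topspace (m_topology X I)"] by simp
  ultimately show ?thesis
    by (simp add: openin_subset subset_antisym)
qed

end

(*
  If some f is unbounded on the set where I does not vanish, choose points x_n there with
  |f(x_n)| >= n. A strictly positive continuous function can be made arbitrarily small at
  the x_n, as a function of |f|. So the functions in I that vanish at all but finitely
  many x_n form a closed subspace, and it is the union of the closed nowhere dense sets
  of those vanishing at x_n for n >= k: it is not Baire. Similarly 0 is not a q-point: near
  0 there are h_n in I with h_n(x_n) > 0 that can only cluster at 0, but some positive u has
  u(x_n) <= h_n(x_n). Being a q-point is a local property, preserved by open continuous
  maps, and it holds at every point of a Cech-complete space.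
  If conversely I-pseudocompactness holds, positive functions are bounded away from 0
  where I does not vanish, so the topology is that of uniform convergence on the cosets of I,
  which is completely metrizable when I is uniformly closed.
*)
theory Submission
  imports Defs
begin

section \<open>Paracompactness of metrizable spaces\<close>

text \<open>M. E. Rudin's proof of Stone's theorem: \<open>D n U\<close> is the \<open>n\<close>-th layer of the refinement inside \<open>U\<close>,
  and \<open>E n\<close> is the union of all earlier layers.\<close>

lemma (in Metric_space) paracompact_space_mtopology: "paracompact_space mtopology"
  unfolding paracompact_space_def
proof (intro conjI allI impI)
  show "Hausdorff_space mtopology"
    by (rule Hausdorff_space_mtopology)
next
  fix \<U> assume "(\<forall>U\<in>\<U>. openin mtopology U) \<and> \<Union>\<U> = topspace mtopology"
  then have op: "\<And>U. U \<in> \<U> \<Longrightarrow> openin mtopology U" and cov: "\<Union>\<U> = M"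
    by auto
  obtain r where r: "well_order_on \<U> r"
    using well_order_on by blast
  then have wf: "wf (r - Id)" and tot: "total_on \<U> r"
    by (auto simp: well_order_on_def linear_order_on_def)
  \<comment> \<open>The well-order lets \<open>c x\<close> be the least member of the cover
    containing x. Minimality is what later separates sets belonging to different members.\<close>
  have "\<exists>U. U \<in> \<U> \<and> x \<in> U \<and> (\<forall>V\<in>\<U>. (V, U) \<in> r - Id \<longrightarrow> x \<notin> V)" if "x \<in> M" for x
  proof -
    obtain U0 where "U0 \<in> {U \<in> \<U>. x \<in> U}"
      using \<open>x \<in> M\<close> cov by auto
    from wfE_min [OF wf this] show ?thesis
      by (metis (mono_tags, lifting) mem_Collect_eq)
  qed
  then obtain c where c\<U>: "\<And>x. x \<in> M \<Longrightarrow> c x \<in> \<U>" and c: "\<And>x. x \<in> M \<Longrightarrow> x \<in> c x"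
    and cmin: "\<And>x V. \<lbrakk>x \<in> M; V \<in> \<U>; (V, c x) \<in> r - Id\<rbrakk> \<Longrightarrow> x \<notin> V"
    by metis
  \<comment> \<open>The factor 3 leaves a gap of more than 1/2^n between balls kept for different
    members of the cover (\<open>sep\<close>). Centres outside the earlier layers keep late balls
    away from the interior of what is already covered (\<open>far\<close>).\<close>
  define E where "E \<equiv> rec_nat {} (\<lambda>n A. A \<union> \<Union>{mball x (1/2^n) |x. x \<in> M \<and> x \<notin> A \<and> mball x (3/2^n) \<subseteq> c x})"
  have E0: "E 0 = {}"
    and ESuc: "E (Suc n) = E n \<union> \<Union>{mball x (1/2^n) |x. x \<in> M \<and> x \<notin> E n \<and> mball x (3/2^n) \<subseteq> c x}" for n
    by (simp_all add: E_def)
  have Emono: "E m \<subseteq> E n" if "m \<le> n" for m n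
    by (rule lift_Suc_mono_le [OF _ that]) (auto simp: ESuc)
  define D where "D \<equiv> \<lambda>n U. \<Union>{mball x (1/2^n) |x. x \<in> M \<and> c x = U \<and> x \<notin> E n \<and> mball x (3/2^n) \<subseteq> U}"
  have inD: "p \<in> D n U \<longleftrightarrow> (\<exists>x. p \<in> mball x (1/2^n) \<and> x \<in> M \<and> c x = U \<and> x \<notin> E n \<and> mball x (3/2^n) \<subseteq> U)"
    for p n U unfolding D_def by blast
  have DE: "D n U \<subseteq> E (Suc n)" for n U
    unfolding D_def ESuc by blast
  have ED: "\<exists>j<n. \<exists>U\<in>\<U>. p \<in> D j U" if "p \<in> E n" for p n
    using that
  proof (induction n)
    case (Suc n)
    then consider "p \<in> E n" | x where "p \<in> mball x (1/2^n)" "x \<in> M" "x \<notin> E n" "mball x (3/2^n) \<subseteq> c x"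
      unfolding ESuc by blast
    then show ?case
    proof cases
      case 1
      with Suc.IH show ?thesis
        using less_Suc_eq by blast
    next
      case 2
      then have "p \<in> D n (c x)"
        by (auto simp only: inD)
      with c\<U> \<open>x \<in> M\<close> show ?thesis
        by blast
    qed
  qed (simp add: E0)
  have DU: "D n U \<subseteq> U" for n U
  proof
    fix p assume "p \<in> D n U"
    then obtain x where x: "p \<in> mball x (1/2^n)" "mball x (3/2^n) \<subseteq> U"
      by (auto simp only: inD)
    have "mball x (1/2^n) \<subseteq> mball x (3/2^n)"
      by (rule mball_subset_concentric) (simp add: divide_simps)
    with x show "p \<in> U" by blast
  qed
  have Dop: "openin mtopology (D n U)" for n U
    unfolding D_def by (rule openin_Union) auto
  \<comment> \<open>The centre z lies outside V because V precedes W = \<open>c z\<close>, while the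
    ball of radius 3/2^i about y lies inside V. Hence the centres are at least 3/2^i apart, and the
    two open balls use up strictly less than 2/2^i.\<close>
  have sep: "1/2^i < d p q" if "p \<in> D i V" "q \<in> D i W" "(V, W) \<in> r - Id" "V \<in> \<U>" for p q i V W
  proof -
    obtain y where y: "p \<in> mball y (1/2^i)" "y \<in> M" "mball y (3/2^i) \<subseteq> V"
      using \<open>p \<in> D i V\<close> by (auto simp only: inD)
    obtain z where z: "q \<in> mball z (1/2^i)" "z \<in> M" "c z = W"
      using \<open>q \<in> D i W\<close> by (auto simp only: inD)
    have "z \<notin> V"
      using cmin z that by blast
    then have "3/2^i \<le> d y z"
      using y z by (force simp: not_less)
    moreover have "d y z \<le> d y p + d p q + d q z"
      using y z by (smt (verit) in_mball triangle)
    ultimately show ?thesis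
      using y z by (simp add: commute)
  qed
  let ?\<V> = "{D n U |n U. U \<in> \<U>}"
  \<comment> \<open>Once n is so large that the 3/2^n-ball about x fits into \<open>c x\<close>,
    either x was covered by an earlier layer or x is itself a centre of layer n.\<close>
  have Vcov: "\<exists>n. \<exists>U\<in>\<U>. x \<in> D n U" if x: "x \<in> M" for x
  proof -
    obtain e where "e > 0" and e: "mball x e \<subseteq> c x"
      using op [OF c\<U> [OF x]] c [OF x] by (auto simp: openin_mtopology)
    obtain n where "(1/2::real)^n < e/3"
      using real_arch_pow_inv [of "e/3" "1/2"] \<open>e > 0\<close> by auto
    then have "mball x (3/2^n) \<subseteq> c x"
      using e by (intro order_trans [OF mball_subset_concentric e]) (simp add: power_divide)
    then have "x \<notin> E n \<Longrightarrow> x \<in> D n (c x)"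
      using x unfolding inD by (intro exI [of _ x]) simp
    then show ?thesis
      using ED c\<U> [OF x] by blast
  qed
  have "\<exists>B. openin mtopology B \<and> x \<in> B \<and> finite {A \<in> ?\<V>. A \<inter> B \<noteq> {}}" if x: "x \<in> M" for x
  proof -
    obtain n U where "U \<in> \<U>" and xD: "x \<in> D n U"
      using Vcov x by blast
    then obtain e where "e > 0" and e: "mball x e \<subseteq> D n U"
      using Dop [of n U] unfolding openin_mtopology by blast
    obtain j where j: "(1/2::real)^j < e"
      using real_arch_pow_inv [of e "1/2"] \<open>e > 0\<close> by auto
    \<comment> \<open>This k serves both halves of local finiteness: layers from k on miss the ball
      \<open>?B\<close>, and each of the finitely many layers below k meets it in at most one
      set.\<close>
    define k where "k = Suc (n + j)"
    let ?B = "mball x (1/2^k)"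
    \<comment> \<open>A centre y of a late layer avoids \<open>E i\<close>, which contains the
      e-ball about x, so y is at distance at least e. Both radii are at most half of 1/2^j < e, so
      the balls cannot meet.\<close>
    have far: "D i V \<inter> ?B = {}" if "k \<le> i" for i V
    proof (rule ccontr)
      assume "D i V \<inter> ?B \<noteq> {}"
      then obtain p y where p: "p \<in> ?B" and y: "p \<in> mball y (1/2^i)" "y \<notin> E i"
        by (auto simp only: inD disjoint_iff)
      have "D n U \<subseteq> E i"
        using DE Emono [of "Suc n" i] \<open>k \<le> i\<close> by (force simp: k_def)
      then have "e \<le> d x y"
        using y e x by (force simp: not_less)
      moreover have "d x y \<le> d x p + d y p"
        using y p x by (simp add: triangle')
      moreover have "(1/2::real)^i \<le> (1/2)^Suc j" "(1/2::real)^k \<le> (1/2)^Suc j"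
        using \<open>k \<le> i\<close> by (auto simp: k_def intro!: power_decreasing simp del: power_Suc)
      ultimately show False
        using p y j by (simp add: power_divide)
    qed
    \<comment> \<open>Points of \<open>?B\<close> are less than 2/2^k \<le> 1/2^i apart, which is
      too close for two different members by \<open>sep\<close>.\<close>
    have near: "V = W" if i: "i < k" and V: "V \<in> \<U>" "D i V \<inter> ?B \<noteq> {}" and W: "W \<in> \<U>" "D i W \<inter> ?B \<noteq> {}" for i V W
    proof (rule ccontr)
      assume "V \<noteq> W"
      obtain p q where pq: "p \<in> D i V" "p \<in> ?B" "q \<in> D i W" "q \<in> ?B"
        using V W by blast
      have "(V, W) \<in> r - Id \<or> (W, V) \<in> r - Id"
        using tot V W \<open>V \<noteq> W\<close> by (auto simp: total_on_def)
      then have "1/2^i < d p q"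
        using sep pq V W commute by metis
      moreover have "d p q \<le> d x p + d x q"
        using pq x by (metis triangle'' in_mball)
      moreover have "(1/2::real)^k \<le> (1/2)^Suc i"
        using i by (auto intro!: power_decreasing simp del: power_Suc)
      ultimately show False
        using pq by (simp add: power_divide)
    qed
    have "finite {D i V |V. V \<in> \<U> \<and> D i V \<inter> ?B \<noteq> {}}" if "i < k" for i
    proof (rule finite_subset)
      \<comment> \<open>If no V qualifies, the choice is arbitrary, but then the set to be covered
        is empty.\<close>
      let ?V = "SOME V. V \<in> \<U> \<and> D i V \<inter> ?B \<noteq> {}"
      show "{D i V |V. V \<in> \<U> \<and> D i V \<inter> ?B \<noteq> {}} \<subseteq> {D i ?V}"
      proof clarify
        fix V assume V: "V \<in> \<U>" "D i V \<inter> ?B \<noteq> {}"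
        then have "?V \<in> \<U> \<and> D i ?V \<inter> ?B \<noteq> {}"
          by (metis (mono_tags, lifting) someI_ex)
        then have "V = ?V"
          by (elim conjE) (rule near [OF \<open>i < k\<close> V])
        then show "D i V = D i ?V"
          by simp
      qed
    qed simp
    then have "finite (\<Union>i<k. {D i V |V. V \<in> \<U> \<and> D i V \<inter> ?B \<noteq> {}})"
      by simp
    moreover have "{A \<in> ?\<V>. A \<inter> ?B \<noteq> {}} \<subseteq> (\<Union>i<k. {D i V |V. V \<in> \<U> \<and> D i V \<inter> ?B \<noteq> {}})"
    proof clarify
      fix i V assume V: "V \<in> \<U>" "D i V \<inter> ?B \<noteq> {}"
      then have "i < k"
        using far not_less by blast
      with V show "D i V \<in> (\<Union>i<k. {D i V |V. V \<in> \<U> \<and> D i V \<inter> ?B \<noteq> {}})"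
        by blast
    qed
    ultimately have "finite {A \<in> ?\<V>. A \<inter> ?B \<noteq> {}}"
      by (rule finite_subset [rotated])
    then show ?thesis
      using x by (intro exI [of _ ?B]) simp
  qed
  moreover have VM: "\<Union>?\<V> \<subseteq> M"
    using openin_subset [OF Dop] by auto
  ultimately have "locally_finite_in mtopology ?\<V>"
    unfolding locally_finite_in_def by simp
  moreover have "\<Union>?\<V> = topspace mtopology"
    using Vcov VM unfolding topspace_mtopology by blast
  ultimately show "\<exists>\<V>. (\<forall>V\<in>\<V>. openin mtopology V) \<and> \<Union>\<V> = topspace mtopology \<and>
            (\<forall>V\<in>\<V>. \<exists>U\<in>\<U>. V \<subseteq> U) \<and> locally_finite_in mtopology \<V>"
    using Dop DU by (intro exI [of _ ?\<V>]) blast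
qed

lemma metrizable_imp_paracompact_space:
  "metrizable_space X \<Longrightarrow> paracompact_space X"
  unfolding metrizable_space_def using Metric_space.paracompact_space_mtopology by blast

section \<open>Cech-complete spaces and q-points\<close>

lemma unit_functions_eq_mspace:
  "unit_functions X = mspace (submetric (cfunspace X euclidean_metric) {f. f \<in> topspace X \<rightarrow> {0..1}})"
proof -
  have "bounded (f ` topspace X)" if "f \<in> topspace X \<rightarrow> {0..1::real}" for f
    using that by (intro bounded_subset [OF bounded_closed_interval [of 0 1]]) auto
  then show ?thesis
    by (auto simp: unit_functions_def continuous_map_in_subtopology)
qed

text \<open>This is the classical embedding of a completely regular Hausdorff space into a cube;
  \<open>unit_functions_eq_mspace\<close> matches the two descriptions of the index set.\<close>

lemma embedding_map_evaluation:
  "tychonoff_space X \<Longrightarrow> embedding_map X (unit_cube X) (evaluation X)"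
  using completely_regular_space_cube_embedding_explicit [of X]
  unfolding tychonoff_space_def unit_cube_def evaluation_def [abs_def] unit_functions_eq_mspace by blast

lemma evaluation_image_subset_unit_cube:
  "evaluation X ` topspace X \<subseteq> topspace (unit_cube X)"
  unfolding unit_cube_def evaluation_def topspace_product_topology
  by (intro image_subsetI restrict_PiE_iff [THEN iffD2] ballI)
     (auto simp: unit_functions_def continuous_map_in_subtopology)

lemma evaluation_image_subset_stone_cech:
  "evaluation X ` topspace X \<subseteq> topspace (stone_cech X)"
  by (simp add: stone_cech_def evaluation_image_subset_unit_cube closure_of_subset closure_of_subset_topspace)

lemma embedding_map_stone_cech:
  "tychonoff_space X \<Longrightarrow> embedding_map X (stone_cech X) (evaluation X)"
  unfolding stone_cech_def
  by (simp add: embedding_map_in_subtopology embedding_map_evaluation closure_of_subset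
      evaluation_image_subset_unit_cube)

lemma Hausdorff_space_stone_cech: "Hausdorff_space (stone_cech X)"
  unfolding stone_cech_def unit_cube_def
  by (simp add: Hausdorff_space_subtopology Hausdorff_space_product_topology)

lemma compact_space_stone_cech: "compact_space (stone_cech X)"
proof -
  have "compact_space (unit_cube X)"
    unfolding unit_cube_def by (simp add: compact_space_product_topology compact_space_subtopology)
  then show ?thesis
    unfolding stone_cech_def
    by (intro compact_space_subtopology closedin_compact_space closedin_closure_of)
qed

lemma evaluation_image_dense_stone_cech:
  "stone_cech X closure_of (evaluation X ` topspace X) = topspace (stone_cech X)"
  unfolding stone_cech_def
  using closure_of_subset [OF evaluation_image_subset_unit_cube, of X]
  by (simp add: closure_of_subtopology Int_absorb1 Int_absorb2 closure_of_subset_topspace)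

text \<open>By Lavrentiev's theorem the identity of S extends to a continuous map g from a G-delta
  set U containing S into S. It agrees with the identity on the dense set S, hence on all of U since
  X is Hausdorff, so U = S.\<close>

lemma completely_metrizable_dense_imp_gdelta_in:
  assumes X: "Hausdorff_space X" and S: "S \<subseteq> topspace X" and dense: "X closure_of S = topspace X"
    and XS: "completely_metrizable_space (subtopology X S)"
  shows "gdelta_in X S"
proof -
  obtain U g where U: "gdelta_in X U" "S \<subseteq> U"
    and contg: "continuous_map (subtopology X (X closure_of S \<inter> U)) (subtopology X S) g"
    and gid: "\<And>x. x \<in> S \<Longrightarrow> g x = x"
    using Lavrentiev_extension_gen [OF S XS, of id] by auto
  have UX: "U \<subseteq> topspace X"
    using U(1) by (rule gdelta_in_subset)
  then have contg': "continuous_map (subtopology X U) (subtopology X S) g"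
    using contg dense by (simp add: Int_absorb1)
  have "x \<in> S" if "x \<in> U" for x
  proof -
    have "x \<in> subtopology X U closure_of S"
      using that UX U(2) dense by (auto simp: closure_of_subtopology Int_absorb1)
    then have "g x = id x"
      using X contg' gid
      by (intro forall_in_closure_of_eq [of x "subtopology X U" S X g id])
         (auto simp: continuous_map_in_subtopology continuous_map_from_subtopology)
    moreover have "g x \<in> S"
      using contg' that UX by (auto simp: continuous_map_in_subtopology)
    ultimately show ?thesis
      by simp
  qed
  then show ?thesis
    using U by (metis subsetI subset_antisym)
qed

text \<open>The evaluation image is a dense, completely metrizable copy of X in its
  compactification, hence a G-delta set there.\<close>

lemma completely_metrizable_imp_cech_complete_space:
  assumes X: "completely_metrizable_space X"
  shows "cech_complete_space X"
proof -
  have "metrizable_space X"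
    using X by (rule completely_metrizable_imp_metrizable_space)
  then have tych: "tychonoff_space X"
    unfolding tychonoff_space_def
    by (simp add: metrizable_imp_completely_regular_space metrizable_imp_Hausdorff_space)
  then have "X homeomorphic_space subtopology (stone_cech X) (evaluation X ` topspace X)"
    by (intro embedding_map_imp_homeomorphic_space embedding_map_stone_cech)
  with X have "completely_metrizable_space (subtopology (stone_cech X) (evaluation X ` topspace X))"
    using homeomorphic_completely_metrizable_space by blast
  then show ?thesis
    unfolding cech_complete_space_def
    by (intro conjI tych completely_metrizable_dense_imp_gdelta_in Hausdorff_space_stone_cech
        evaluation_image_subset_stone_cech evaluation_image_dense_stone_cech)
qed

lemma completely_metrizable_imp_hereditarily_baire_space:
  assumes X: "completely_metrizable_space X"
  shows "hereditarily_baire_space X"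
  unfolding hereditarily_baire_space_def baire_space_def
proof (intro allI impI)
  fix S and U :: "nat \<Rightarrow> 'a set"
  assume "closedin X S"
    and U: "\<forall>n. openin (subtopology X S) (U n) \<and> subtopology X S closure_of U n = topspace (subtopology X S)"
  then have "completely_metrizable_space (subtopology X S)"
    by (simp add: X completely_metrizable_space_closedin)
  then show "subtopology X S closure_of \<Inter> (range U) = topspace (subtopology X S)"
    using U by (intro Baire_category) auto
qed

text \<open>The q-spaces of Michael are the spaces in which every point has this property.\<close>

definition q_point :: "'a topology \<Rightarrow> 'a \<Rightarrow> bool"
  where "q_point X x \<longleftrightarrow>
    (\<exists>U :: nat \<Rightarrow> 'a set. (\<forall>n. openin X (U n) \<and> x \<in> U n) \<and>
       (\<forall>s. (\<forall>n. s n \<in> U n) \<longrightarrow>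
          (\<exists>y\<in>topspace X. \<forall>V. openin X V \<and> y \<in> V \<longrightarrow> (\<exists>\<^sub>F n in sequentially. s n \<in> V))))"

text \<open>The closures of the tails are decreasing, nonempty and closed, so compactness gives a
  common point.\<close>

lemma compact_space_cluster_point:
  fixes s :: "nat \<Rightarrow> 'a"
  assumes X: "compact_space X" and s: "\<And>n. s n \<in> topspace X"
  obtains y where "y \<in> topspace X" "\<And>V. openin X V \<Longrightarrow> y \<in> V \<Longrightarrow> \<exists>\<^sub>F n in sequentially. s n \<in> V"
proof -
  let ?C = "\<lambda>n. X closure_of (s ` {n..})"
  have "(\<Inter>n. ?C n) \<noteq> {}"
  proof (rule compact_space_imp_nest [OF X])
    show "closedin X (?C n)" for n
      by simp
    have "s n \<in> ?C n" for n
      using closure_of_subset [of "s ` {n..}" X] s by (auto simp: image_subset_iff)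
    then show "?C n \<noteq> {}" for n
      by blast
    show "decseq ?C"
      by (auto simp: decseq_def intro!: closure_of_mono)
  qed
  then obtain y where y: "\<And>n. y \<in> ?C n"
    by blast
  show thesis
  proof
    show "y \<in> topspace X"
      using y by (auto simp: in_closure_of)
    fix V assume "openin X V" "y \<in> V"
    then show "\<exists>\<^sub>F n in sequentially. s n \<in> V"
      using y unfolding in_closure_of frequently_sequentially by (metis atLeast_iff imageE)
  qed
qed

text \<open>Write Y as the intersection of open sets \<open>G n\<close> of the compactification and
  shrink each around y to \<open>U n\<close>, inside a closed \<open>V n\<close> within
  \<open>G n\<close>. A sequence eventually in each \<open>U n\<close> clusters in the
  compactification, and the cluster point lies in every \<open>V n\<close>, hence in Y.\<close>

lemma cech_complete_imp_q_point:
  assumes Y: "cech_complete_space Y" and y: "y \<in> topspace Y"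
  shows "q_point Y y"
proof -
  let ?B = "stone_cech Y" and ?e = "evaluation Y"
  have tych: "tychonoff_space Y" and G: "gdelta_in ?B (?e ` topspace Y)"
    using Y by (auto simp: cech_complete_space_def)
  obtain G :: "nat \<Rightarrow> _" where Gop: "\<And>n. openin ?B (G n)" and G: "\<Inter>(range G) = ?e ` topspace Y"
    using G unfolding gdelta_in_descending by metis
  have "regular_space ?B"
    by (simp add: Hausdorff_space_stone_cech compact_space_stone_cech compact_Hausdorff_imp_regular_space)
  then have reg: "\<exists>U V. openin ?B U \<and> closedin ?B V \<and> x \<in> U \<and> U \<subseteq> V \<and> V \<subseteq> W"
    if "openin ?B W" "x \<in> W" for W x
    using that unfolding neighbourhood_base_of_closedin [symmetric] neighbourhood_base_of by blast
  have "?e y \<in> G n" for n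
    using G y by blast
  then have "\<exists>U V. openin ?B U \<and> closedin ?B V \<and> ?e y \<in> U \<and> U \<subseteq> V \<and> V \<subseteq> G n" for n
    by (intro reg Gop)
  then obtain U V where UV: "\<And>n. openin ?B (U n)" "\<And>n. closedin ?B (V n)"
      "\<And>n. ?e y \<in> U n" "\<And>n. U n \<subseteq> V n" "\<And>n. V n \<subseteq> G n"
    by metis
  have emb: "homeomorphic_map Y (subtopology ?B (?e ` topspace Y)) ?e"
    using embedding_map_stone_cech [OF tych] by (simp add: embedding_map_def)
  then have conte: "continuous_map Y ?B ?e"
    by (rule continuous_map_into_fulltopology [OF homeomorphic_imp_continuous_map])
  \<comment> \<open>Intersecting the first sets makes a whole tail of the sequence, not just one
    term, lie in each \<open>U i\<close>.\<close>
  define N where "N \<equiv> \<lambda>n. {x \<in> topspace Y. \<forall>i\<le>n. ?e x \<in> U i}"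
  show ?thesis
    unfolding q_point_def
  proof (intro exI [of _ N] conjI allI impI)
    fix n
    have "N n = topspace Y \<inter> (\<Inter>i\<in>{..n}. {x \<in> topspace Y. ?e x \<in> U i})"
      by (auto simp: N_def)
    moreover have "openin Y \<dots>"
      using conte UV by (intro openin_Int openin_INT) (auto intro: openin_continuous_map_preimage)
    ultimately show "openin Y (N n)"
      by simp
    show "y \<in> N n"
      using y UV by (simp add: N_def)
  next
    fix s assume s: "\<forall>n. s n \<in> N n"
    then have sY: "s n \<in> topspace Y" for n
      by (auto simp: N_def)
    then obtain p where p: "p \<in> topspace ?B"
      and clus: "\<And>W. openin ?B W \<Longrightarrow> p \<in> W \<Longrightarrow> \<exists>\<^sub>F n in sequentially. ?e (s n) \<in> W"
      using compact_space_cluster_point [of ?B "\<lambda>n. ?e (s n)"] compact_space_stone_cech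
        evaluation_image_subset_stone_cech by (metis image_subset_iff)
    \<comment> \<open>Otherwise the complement of \<open>V i\<close> would be a neighbourhood of p
      visited at arbitrarily late times, although all terms from i on lie in
      \<open>U i\<close>.\<close>
    have "p \<in> V i" for i
    proof (rule ccontr)
      assume "p \<notin> V i"
      then have "\<exists>\<^sub>F n in sequentially. ?e (s n) \<in> topspace ?B - V i"
        using clus p UV(2) by blast
      then obtain n where "n \<ge> i" "?e (s n) \<notin> V i"
        unfolding frequently_sequentially by auto
      then show False
        using s UV(4) by (auto simp: N_def)
    qed
    then obtain z where z: "z \<in> topspace Y" "p = ?e z"
      using G UV(5) by blast
    show "\<exists>y\<in>topspace Y. \<forall>W. openin Y W \<and> y \<in> W \<longrightarrow> (\<exists>\<^sub>F n in sequentially. s n \<in> W)"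
    proof (intro bexI [of _ z] z allI impI, elim conjE)
      fix W assume W: "openin Y W" "z \<in> W"
      \<comment> \<open>The cluster property is known only for open sets of the compactification, so
        W is written as the trace of such a set T; injectivity then pulls membership back to
        W.\<close>
      then have "openin (subtopology ?B (?e ` topspace Y)) (?e ` W)"
        using emb homeomorphic_map_openness_eq by blast
      then obtain T where T: "openin ?B T" "?e ` W = T \<inter> ?e ` topspace Y"
        by (auto simp: openin_subtopology)
      have inj: "inj_on ?e (topspace Y)"
        using emb homeomorphic_imp_injective_map by blast
      have "p \<in> T"
        using T W z by blast
      then have "\<exists>\<^sub>F n in sequentially. ?e (s n) \<in> T"
        using clus T by blast
      then show "\<exists>\<^sub>F n in sequentially. s n \<in> W"
      proof (rule frequently_elim1)
        fix n assume "?e (s n) \<in> T"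
        then have "?e (s n) \<in> ?e ` W"
          using T sY by blast
        then show "s n \<in> W"
          using inj sY openin_subset [OF W(1)] by (meson inj_on_image_mem_iff)
      qed
    qed
  qed
qed

text \<open>Openness makes the images of the witnessing neighbourhoods open. A sequence in them
  lifts to Y, and continuity carries a cluster point of the lift to one of the sequence.\<close>

lemma q_point_open_continuous_image:
  assumes q: "open_continuous_image_via Y Z q" and y: "q_point Y y"
  shows "q_point Z (q y)"
proof -
  obtain U :: "nat \<Rightarrow> 'a set" where U: "\<forall>n. openin Y (U n) \<and> y \<in> U n"
    and cl: "\<forall>s. (\<forall>n. s n \<in> U n) \<longrightarrow>
       (\<exists>x\<in>topspace Y. \<forall>V. openin Y V \<and> x \<in> V \<longrightarrow> (\<exists>\<^sub>F n in sequentially. s n \<in> V))"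
    using y unfolding q_point_def by (elim exE conjE) (rule that)
  show ?thesis
    unfolding q_point_def
  proof (intro exI [of _ "\<lambda>n. q ` U n"] conjI allI impI)
    show "openin Z (q ` U n)" for n
      using q U by (simp add: open_continuous_image_via_def open_map_def)
    show "q y \<in> q ` U n" for n
      using U by blast
    fix s assume "\<forall>n. s n \<in> q ` U n"
    then have "\<forall>n. \<exists>u. u \<in> U n \<and> s n = q u"
      by blast
    then obtain t where "\<forall>n. t n \<in> U n \<and> s n = q (t n)"
      by (rule choice [THEN exE])
    then have t: "\<And>n. t n \<in> U n" "\<And>n. s n = q (t n)"
      by auto
    obtain x where x: "x \<in> topspace Y" "\<forall>V. openin Y V \<and> x \<in> V \<longrightarrow> (\<exists>\<^sub>F n in sequentially. t n \<in> V)"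
      using cl [rule_format, OF t(1)] by blast
    have contq: "continuous_map Y Z q"
      using q by (simp add: open_continuous_image_via_def)
    show "\<exists>z\<in>topspace Z. \<forall>V. openin Z V \<and> z \<in> V \<longrightarrow> (\<exists>\<^sub>F n in sequentially. s n \<in> V)"
    proof (intro bexI [of _ "q x"] allI impI, elim conjE)
      show "q x \<in> topspace Z"
        using x contq continuous_map_image_subset_topspace by fastforce
      fix V assume V: "openin Z V" "q x \<in> V"
      then have "openin Y {u \<in> topspace Y. q u \<in> V}"
        using contq openin_continuous_map_preimage by blast
      then have "\<exists>\<^sub>F n in sequentially. t n \<in> {u \<in> topspace Y. q u \<in> V}"
        using x V by blast
      then show "\<exists>\<^sub>F n in sequentially. s n \<in> V"
        by (rule frequently_elim1) (simp add: t)
    qed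
  qed
qed

text \<open>The neighbourhood N may fail to be open, so the witnesses found in N are cut down to the
  open set W, where relative openness becomes openness in Y. A cluster point in N is also one in
  Y.\<close>

lemma locally_cech_complete_imp_q_point:
  assumes Y: "locally_cech_complete_space Y" and y: "y \<in> topspace Y"
  shows "q_point Y y"
proof -
  obtain W N where W: "openin Y W" "y \<in> W" and N: "W \<subseteq> N" "N \<subseteq> topspace Y"
    and "cech_complete_space (subtopology Y N)"
    using assms unfolding locally_cech_complete_space_def by metis
  then have "q_point (subtopology Y N) y"
    by (intro cech_complete_imp_q_point) auto
  then obtain U :: "nat \<Rightarrow> 'a set" where U: "\<forall>n. openin (subtopology Y N) (U n) \<and> y \<in> U n"
    and cl: "\<forall>s. (\<forall>n. s n \<in> U n) \<longrightarrow> (\<exists>x\<in>topspace (subtopology Y N).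
       \<forall>V. openin (subtopology Y N) V \<and> x \<in> V \<longrightarrow> (\<exists>\<^sub>F n in sequentially. s n \<in> V))"
    unfolding q_point_def by (elim exE conjE) (rule that)
  show ?thesis
    unfolding q_point_def
  proof (intro exI [of _ "\<lambda>n. U n \<inter> W"] conjI allI impI)
    fix n
    obtain T where T: "openin Y T" "U n = T \<inter> N"
      using U by (auto simp: openin_subtopology)
    then have "U n \<inter> W = T \<inter> W"
      using N by blast
    then show "openin Y (U n \<inter> W)"
      using T W by (simp add: openin_Int)
    show "y \<in> U n \<inter> W"
      using U W by blast
  next
    fix s assume s: "\<forall>n. s n \<in> U n \<inter> W"
    then obtain x where x: "x \<in> topspace (subtopology Y N)"
      and clx: "\<forall>V. openin (subtopology Y N) V \<and> x \<in> V \<longrightarrow> (\<exists>\<^sub>F n in sequentially. s n \<in> V)"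
      using cl [rule_format, of s] by blast
    show "\<exists>x\<in>topspace Y. \<forall>V. openin Y V \<and> x \<in> V \<longrightarrow> (\<exists>\<^sub>F n in sequentially. s n \<in> V)"
    proof (intro bexI [of _ x] allI impI, elim conjE)
      show "x \<in> topspace Y"
        using x by simp
      fix V assume "openin Y V" "x \<in> V"
      then have "\<exists>\<^sub>F n in sequentially. s n \<in> V \<inter> N"
        using x clx [rule_format, of "V \<inter> N"] by (simp add: openin_subtopology_Int)
      then show "\<exists>\<^sub>F n in sequentially. s n \<in> V"
        by (rule frequently_elim1) simp
    qed
  qed
qed

section \<open>Functions in the ideal\<close>

lemma restrict_in_C_pos:
  assumes "continuous_map X euclideanreal u" "\<And>x. x \<in> topspace X \<Longrightarrow> 0 < u x"
  shows "(\<lambda>x\<in>topspace X. u x) \<in> C_pos X"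
  using assms by (simp add: C_pos_def restrict_in_C_ring)

text \<open>This meets countably many positive bounds \<open>c n\<close> at once, at points
  \<open>p n\<close> where |f| is at least n. The function is \<open>\<psi>\<close> of |f|, where
  the penalty \<open>max 0 (real n - t)\<close> disappears once t \<ge> n.\<close>

lemma C_pos_below:
  fixes c :: "nat \<Rightarrow> real"
  assumes f: "continuous_map X euclideanreal f" and c: "\<And>n. 0 < c n"
  obtains v where "v \<in> C_pos X" "\<And>x n. x \<in> topspace X \<Longrightarrow> real n \<le> \<bar>f x\<bar> \<Longrightarrow> v x \<le> c n"
proof -
  \<comment> \<open>\<open>\<psi>\<close> is 1-Lipschitz, being an infimum of 1-Lipschitz functions.\<close>
  define \<psi> where "\<psi> \<equiv> \<lambda>t. INF n. c n + max 0 (real n - t)"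
  have bdd: "bdd_below (range (\<lambda>n. c n + max 0 (real n - t)))" for t
    using c by (intro bdd_belowI [of _ 0]) (force intro: add_nonneg_nonneg less_imp_le)
  have lower: "\<psi> t \<le> c n + max 0 (real n - t)" for t n
    unfolding \<psi>_def by (rule cINF_lower [OF bdd]) simp
  have lip: "\<psi> s \<le> \<psi> t + \<bar>s - t\<bar>" for s t
  proof -
    have "\<psi> s - \<bar>s - t\<bar> \<le> c n + max 0 (real n - t)" for n
      using lower [of s n] by linarith
    then have "\<psi> s - \<bar>s - t\<bar> \<le> (INF n. c n + max 0 (real n - t))"
      by (intro cINF_greatest) auto
    then show ?thesis
      by (simp add: \<psi>_def)
  qed
  have "isCont \<psi> t" for t
    unfolding continuous_at_eps_delta
  proof (intro allI impI)
    fix e :: real assume "e > 0"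
    have "dist (\<psi> s) (\<psi> t) \<le> dist s t" for s
      using lip [of s t] lip [of t s] by (auto simp: dist_real_def)
    then show "\<exists>d>0. \<forall>s. dist s t < d \<longrightarrow> dist (\<psi> s) (\<psi> t) < e"
      using \<open>e > 0\<close> by (metis order_le_less_trans)
  qed
  then have "continuous_map euclideanreal euclideanreal \<psi>"
    by (simp add: continuous_on_eq_continuous_at)
  then have "continuous_map X euclideanreal (\<psi> \<circ> (\<lambda>x. \<bar>f x\<bar>))"
    by (intro continuous_map_compose [of _ euclideanreal] continuous_map_real_abs f)
  moreover have "0 < \<psi> t" for t
  proof -
    obtain m where m: "t + 1 \<le> real m"
      using real_arch_simple by blast
    \<comment> \<open>For n \<le> m the term is at least \<open>c n\<close>; for n > m the penalty
      alone exceeds 1. Thus only finitely many \<open>c n\<close> affect the lower bound.\<close>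
    let ?e = "Min (insert 1 (c ` {..m}))"
    have "?e \<le> c n + max 0 (real n - t)" for n
    proof (cases "n \<le> m")
      case True
      then have "?e \<le> c n"
        by (intro Min_le) auto
      then show ?thesis by simp
    next
      case False
      have "?e \<le> 1"
        by (intro Min_le) auto
      with False m c [of n] show ?thesis by simp
    qed
    then have "?e \<le> \<psi> t"
      unfolding \<psi>_def by (intro cINF_greatest) auto
    moreover have "0 < ?e"
      using c by auto
    ultimately show ?thesis by linarith
  qed
  ultimately have "(\<lambda>x\<in>topspace X. \<psi> \<bar>f x\<bar>) \<in> C_pos X"
    by (intro restrict_in_C_pos) (auto simp: o_def)
  then show thesis
  proof (rule that)
    fix x n assume "x \<in> topspace X" "real n \<le> \<bar>f x\<bar>"
    then show "(\<lambda>x\<in>topspace X. \<psi> \<bar>f x\<bar>) x \<le> c n"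
      using lower [of "\<bar>f x\<bar>" n] by simp
  qed
qed

context
  fixes X :: "'a topology" and I :: "('a \<Rightarrow> real) set"
  assumes I: "ideal I (C_ring X)"
begin

section \<open>Arithmetic and small bumps in the ideal\<close>

lemma C_ideal_carrier: "h \<in> I \<Longrightarrow> h \<in> carrier (C_ring X)"
  using additive_subgroup.a_Hcarr [OF ideal.axioms(1) [OF I]] .

lemma C_ideal_continuous: "h \<in> I \<Longrightarrow> continuous_map X euclideanreal h"
  using C_ideal_carrier by (simp add: carrier_C_ring_iff)

lemma C_ideal_zero: "(\<lambda>x\<in>topspace X. 0) \<in> I"
  using additive_subgroup.zero_closed [OF ideal.axioms(1) [OF I]] by (simp add: C_ring_def)

lemma C_ideal_add:
  assumes "h \<in> I" "k \<in> I" shows "(\<lambda>x\<in>topspace X. h x + k x) \<in> I"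
  using additive_subgroup.a_closed [OF ideal.axioms(1) [OF I] assms] by (simp add: C_ring_def)

lemma C_ideal_mult:
  assumes "continuous_map X euclideanreal w" "h \<in> I" shows "(\<lambda>x\<in>topspace X. w x * h x) \<in> I"
proof -
  have "(\<lambda>x\<in>topspace X. w x) \<otimes>\<^bsub>C_ring X\<^esub> h \<in> I"
    by (intro ideal.I_l_closed [OF I] assms restrict_in_C_ring)
  then show ?thesis
    by (simp add: C_ring_def cong: restrict_cong)
qed

text \<open>Members of I are extensional, so their values on X determine them. This turns pointwise
  identities into membership in I.\<close>

lemma C_ideal_cong:
  assumes "h \<in> I" "\<And>x. x \<in> topspace X \<Longrightarrow> h x = k x" shows "(\<lambda>x\<in>topspace X. k x) \<in> I"
proof -
  have "(\<lambda>x\<in>topspace X. k x) = h"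
    using C_ideal_carrier [OF assms(1)] assms(2)
    by (auto simp: carrier_C_ring_iff extensional_def restrict_def)
  with assms show ?thesis by simp
qed

lemma C_ideal_minus:
  assumes "(\<lambda>x\<in>topspace X. f x - g x) \<in> I" shows "(\<lambda>x\<in>topspace X. g x - f x) \<in> I"
  by (rule C_ideal_cong [OF C_ideal_mult [OF _ assms, of "\<lambda>x. -1"]]) auto

lemma C_ideal_diff_trans:
  assumes "(\<lambda>x\<in>topspace X. f x - g x) \<in> I" "(\<lambda>x\<in>topspace X. g x - h x) \<in> I"
  shows "(\<lambda>x\<in>topspace X. f x - h x) \<in> I"
  by (rule C_ideal_cong [OF C_ideal_add [OF assms]]) auto

lemma C_ideal_diff:
  assumes "h \<in> I" "k \<in> I" shows "(\<lambda>x\<in>topspace X. h x - k x) \<in> I"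
  by (rule C_ideal_cong [OF C_ideal_add [OF assms(1) C_ideal_mult [OF _ assms(2), of "\<lambda>x. -1"]]]) auto

lemma openin_B_m:
  assumes "f \<in> carrier (C_ring X)" "u \<in> C_pos X" shows "openin (m_topology X I) (B_m X f I u)"
  unfolding m_topology_def by (rule topology_generated_by_Basis) (use assms in blast)

text \<open>Choose a in I with a(p) \<noteq> 0 and take h = u a^2 / (1 + a^2). It is a continuous
  multiple of a, and t / (1 + t) lies in [0,1) for t \<ge> 0.\<close>

lemma C_ideal_bump:
  assumes p: "p \<in> topspace X - (\<Inter>g\<in>I. zero_set X g)" and u: "u \<in> C_pos X"
  obtains h where "h \<in> I" "\<And>x. x \<in> topspace X \<Longrightarrow> 0 \<le> h x \<and> h x < u x" "0 < h p"
proof -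
  obtain a where a: "a \<in> I" "a p \<noteq> 0"
    using p by (auto simp: zero_set_def)
  have pos: "0 < 1 + (a x)\<^sup>2" for x
    by (smt (verit) zero_le_power2)
  have "continuous_map X euclideanreal (\<lambda>x. u x * a x / (1 + (a x)\<^sup>2))"
    using u C_ideal_continuous [OF a(1)] pos
    by (intro continuous_map_real_divide continuous_map_real_mult continuous_map_add continuous_map_real_pow)
       (auto simp: C_pos_def carrier_C_ring_iff less_imp_neq [THEN not_sym])
  from C_ideal_mult [OF this a(1)] show thesis
  proof (rule that)
    fix x assume x: "x \<in> topspace X"
    then have "0 < u x"
      using u by (simp add: C_pos_def)
    then have "u x * (a x)\<^sup>2 / (1 + (a x)\<^sup>2) < u x"
      using pos [of x] by (simp add: divide_simps algebra_simps)
    moreover have "0 \<le> u x * (a x)\<^sup>2 / (1 + (a x)\<^sup>2)"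
      using \<open>0 < u x\<close> pos [of x] by simp
    ultimately show "0 \<le> (\<lambda>x\<in>topspace X. u x * a x / (1 + (a x)\<^sup>2) * a x) x \<and>
        (\<lambda>x\<in>topspace X. u x * a x / (1 + (a x)\<^sup>2) * a x) x < u x"
      using x by (simp add: power2_eq_square mult.assoc)
  next
    have "0 < u p * (a p)\<^sup>2 / (1 + (a p)\<^sup>2)"
      using u p a pos [of p] by (simp add: C_pos_def)
    then show "0 < (\<lambda>x\<in>topspace X. u x * a x / (1 + (a x)\<^sup>2) * a x) p"
      using p by (simp add: power2_eq_square mult.assoc)
  qed
qed

section \<open>Consequences of a failure of I-pseudocompactness\<close>

lemma not_I_pseudocompact_sequence:
  assumes "\<not> I_pseudocompact X I"
  obtains f p where "continuous_map X euclideanreal f"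
    "\<And>n. p n \<in> topspace X - (\<Inter>g\<in>I. zero_set X g)" "\<And>n::nat. real n \<le> \<bar>f (p n)\<bar>"
proof -
  let ?Y = "topspace X - (\<Inter>g\<in>I. zero_set X g)"
  obtain f where f: "f \<in> carrier (C_ring X)" "\<not> bounded (f ` ?Y)"
    using assms by (auto simp: I_pseudocompact_def bounded_subset_def)
  have "\<exists>x. x \<in> ?Y \<and> real n \<le> \<bar>f x\<bar>" for n
  proof (rule ccontr)
    assume "\<nexists>x. x \<in> ?Y \<and> real n \<le> \<bar>f x\<bar>"
    then have "\<bar>f x\<bar> \<le> real n" if "x \<in> ?Y" for x
      using that by (meson linorder_linear)
    then have "bounded (f ` ?Y)"
      unfolding bounded_iff by (intro exI [of _ "real n"]) auto
    with f show False by blast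
  qed
  then obtain p where "\<And>n. p n \<in> ?Y \<and> real n \<le> \<bar>f (p n)\<bar>"
    by metis
  then show thesis
    using f by (intro that [of f p]) (auto simp: carrier_C_ring_iff)
qed

lemma hereditarily_baire_imp_I_pseudocompact:
  assumes hb: "hereditarily_baire_space (m_topology X I)"
  shows "I_pseudocompact X I"
proof (rule ccontr)
  assume "\<not> I_pseudocompact X I"
  then obtain f p where f: "continuous_map X euclideanreal f"
    and p: "\<And>n. p n \<in> topspace X - (\<Inter>g\<in>I. zero_set X g)" and fp: "\<And>n::nat. real n \<le> \<bar>f (p n)\<bar>"
    using not_I_pseudocompact_sequence by blast
  let ?M = "m_topology X I" and ?C = "carrier (C_ring X)"
  have pX: "p n \<in> topspace X" for n
    using p by blast
  \<comment> \<open>Each member of S vanishes at \<open>p n\<close> from some index on, which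
    exhibits S as a countable union; the density argument below shows that its pieces are nowhere
    dense.\<close>
  define S where "S \<equiv> {h \<in> I. finite {n. h (p n) \<noteq> 0}}"
  let ?T = "subtopology ?M S"
  have SC: "S \<subseteq> ?C"
    using C_ideal_carrier by (auto simp: S_def)
  have "closedin ?M S"
    unfolding closedin_def topspace_m_topology [OF I] openin_m_topology_iff [OF I]
  proof (intro conjI SC ballI)
    fix h assume h: "h \<in> ?C - S"
    show "\<exists>u\<in>C_pos X. B_m X h I u \<subseteq> ?C - S"
    proof (cases "h \<in> I")
      case False
      \<comment> \<open>The ball stays in the coset of h, and this coset is disjoint from I; hence
        any radius function works.\<close>
      have "g \<notin> I" if "g \<in> B_m X h I u" for g u
      proof
        assume "g \<in> I"
        have hg: "(\<lambda>x\<in>topspace X. h x - g x) \<in> I"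
          using that by (simp add: B_m_def)
        have "(\<lambda>x\<in>topspace X. h x) \<in> I"
          by (rule C_ideal_cong [OF C_ideal_add [OF hg \<open>g \<in> I\<close>]]) simp
        then show False
          using h False by (auto simp: carrier_C_ring_iff extensional_restrict)
      qed
      moreover have "(\<lambda>x\<in>topspace X. 1) \<in> C_pos X"
        by (intro restrict_in_C_pos) auto
      ultimately show ?thesis
        by (auto simp: S_def B_m_def)
    next
      case True
      then have inf: "infinite {n. h (p n) \<noteq> 0}"
        using h by (simp add: S_def)
      \<comment> \<open>With v(p n) \<le> |h(p n)|, no g in the ball can vanish at a
        \<open>p n\<close> where h does not. The value 1 at zeros of h only keeps c
        positive.\<close>
      define c where "c \<equiv> \<lambda>n. if h (p n) = 0 then 1 else \<bar>h (p n)\<bar>"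
      have "0 < c n" for n
        by (simp add: c_def)
      then obtain v where v: "v \<in> C_pos X"
        and vc: "\<And>x n. x \<in> topspace X \<Longrightarrow> real n \<le> \<bar>f x\<bar> \<Longrightarrow> v x \<le> c n"
        using C_pos_below [OF f, of c] by blast
      have "g \<notin> S" if g: "g \<in> B_m X h I v" for g
      proof -
        have "g (p n) \<noteq> 0" if "h (p n) \<noteq> 0" for n
        proof
          assume "g (p n) = 0"
          then have "\<bar>h (p n)\<bar> < v (p n)"
            using g pX [of n] by (auto simp: B_m_def)
          then show False
            using vc [OF pX fp, of n] that by (simp add: c_def)
        qed
        then have "{n. h (p n) \<noteq> 0} \<subseteq> {n. g (p n) \<noteq> 0}"
          by blast
        then show ?thesis
          using inf finite_subset by (auto simp: S_def)
      qed
      with v show ?thesis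
        by (auto simp: B_m_def)
    qed
  qed blast
  then have baire: "baire_space ?T"
    using hb by (simp add: hereditarily_baire_space_def)
  \<comment> \<open>\<open>U k\<close> is the complement in S of the functions that vanish at
    \<open>p n\<close> for all n \<ge> k.\<close>
  define U where "U \<equiv> \<lambda>k. S \<inter> {h \<in> ?C. \<exists>n\<ge>k. h (p n) \<noteq> 0}"
  have Uop: "openin ?T (U k)" for k
  proof -
    have "openin ?M {h \<in> ?C. \<exists>n\<ge>k. h (p n) \<noteq> 0}"
      unfolding openin_m_topology_iff [OF I]
    proof (intro conjI ballI)
      fix h assume "h \<in> {h \<in> ?C. \<exists>n\<ge>k. h (p n) \<noteq> 0}"
      then obtain n where n: "n \<ge> k" "h (p n) \<noteq> 0"
        by blast
      \<comment> \<open>A g vanishing at \<open>p n\<close> would differ from h there by exactly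
        this radius, which the strict inequality in \<open>B_m\<close> forbids.\<close>
      let ?u = "\<lambda>x\<in>topspace X. \<bar>h (p n)\<bar>"
      have u: "?u \<in> C_pos X"
        using n by (intro restrict_in_C_pos) auto
      have "g \<in> {h \<in> ?C. \<exists>n\<ge>k. h (p n) \<noteq> 0}" if g: "g \<in> B_m X h I ?u" for g
      proof -
        have "g (p n) \<noteq> 0"
        proof
          assume "g (p n) = 0"
          then show False
            using g pX [of n] by (auto simp: B_m_def)
        qed
        moreover have "g \<in> ?C"
          using g by (simp add: B_m_def)
        ultimately show ?thesis
          using n(1) by blast
      qed
      with u show "\<exists>u\<in>C_pos X. B_m X h I u \<subseteq> {h \<in> ?C. \<exists>n\<ge>k. h (p n) \<noteq> 0}"
        by (meson subsetI)
    qed blast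
    then show ?thesis
      unfolding U_def by (rule openin_subtopology_Int2)
  qed
  have Udense: "?T closure_of (U k) = topspace ?T" for k
  proof -
    have dense: "\<exists>g\<in>U k. g \<in> W" if h: "h \<in> S" and W: "openin ?M W" "h \<in> W" for h W
    proof (cases "h (p k) = 0")
      case False
      then show ?thesis
        using h W SC by (auto simp: U_def)
    next
      case True
      obtain u where u: "u \<in> C_pos X" "B_m X h I u \<subseteq> W"
        using W by (auto simp: openin_m_topology_iff [OF I])
      obtain a where a: "a \<in> I" "\<And>x. x \<in> topspace X \<Longrightarrow> 0 \<le> a x \<and> a x < u x" "0 < a (p k)"
        using C_ideal_bump [OF p u(1)] by blast
      \<comment> \<open>A tent in |f| equal to 1 at \<open>p k\<close>. If it is nonzero at
        \<open>p n\<close>, then n \<le> |f(p n)| < |f(p k)| + 1, so adding w a makes h nonzero at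
        \<open>p k\<close> but changes it at only finitely many indices and stays in S.\<close>
      define w where "w \<equiv> \<lambda>x. max 0 (1 - \<bar>\<bar>f x\<bar> - \<bar>f (p k)\<bar>\<bar>)"
      have w: "continuous_map X euclideanreal w" "\<And>x. 0 \<le> w x \<and> w x \<le> 1"
        unfolding w_def by (intro continuous_map_real_max continuous_map_diff continuous_map_real_abs f) auto
      define g where "g = (\<lambda>x\<in>topspace X. h x + (\<lambda>x\<in>topspace X. w x * a x) x)"
      have hI: "h \<in> I"
        using h by (simp add: S_def)
      have gI: "g \<in> I"
        unfolding g_def by (intro C_ideal_add C_ideal_mult hI w a)
      have gx: "g x = h x + w x * a x" if "x \<in> topspace X" for x
        using that by (simp add: g_def)
      have "\<bar>h x - g x\<bar> < u x" if x: "x \<in> topspace X" for x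
      proof -
        have "w x * a x \<le> 1 * a x"
          using w a(2) x by (intro mult_right_mono) auto
        moreover have "0 \<le> w x * a x"
          using w a(2) x by simp
        ultimately show ?thesis
          using a(2) [OF x] gx [OF x] by linarith
      qed
      then have "g \<in> B_m X h I u"
        using C_ideal_diff [OF hI gI] C_ideal_carrier [OF gI] by (simp add: B_m_def)
      then have "g \<in> W"
        using u by blast
      have "{n. g (p n) \<noteq> 0} \<subseteq> {n. h (p n) \<noteq> 0} \<union> {..nat \<lceil>\<bar>f (p k)\<bar> + 1\<rceil>}"
      proof
        fix n assume "n \<in> {n. g (p n) \<noteq> 0}"
        then have "h (p n) \<noteq> 0 \<or> w (p n) \<noteq> 0"
          using gx [OF pX] by auto
        then show "n \<in> {n. h (p n) \<noteq> 0} \<union> {..nat \<lceil>\<bar>f (p k)\<bar> + 1\<rceil>}"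
        proof
          assume "w (p n) \<noteq> 0"
          then have "real n \<le> \<bar>f (p k)\<bar> + 1"
            using fp [of n] by (auto simp: w_def max_def split: if_splits)
          then have "n \<le> nat \<lceil>\<bar>f (p k)\<bar> + 1\<rceil>"
            by linarith
          then show ?thesis by simp
        qed simp
      qed
      then have "g \<in> S"
        using gI h by (auto simp: S_def intro: finite_subset)
      moreover have "g (p k) \<noteq> 0"
        using gx [OF pX] True a(3) by (simp add: w_def)
      ultimately show ?thesis
        using \<open>g \<in> W\<close> SC by (auto simp: U_def)
    qed
    have "h \<in> ?T closure_of (U k)" if h: "h \<in> topspace ?T" for h
      unfolding in_closure_of
    proof (intro conjI h allI impI, elim conjE)
      fix V assume "h \<in> V" "openin ?T V"
      then obtain W where W: "openin ?M W" "h \<in> W" "V = W \<inter> S"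
        by (auto simp: openin_subtopology)
      then obtain g where "g \<in> U k" "g \<in> W"
        using dense h by auto
      then show "\<exists>g. g \<in> U k \<and> g \<in> V"
        using W(3) by (auto simp: U_def)
    qed
    then have "topspace ?T \<subseteq> ?T closure_of (U k)"
      by blast
    then show ?thesis
      by (intro subset_antisym closure_of_subset_topspace)
  qed
  have "?T closure_of (\<Inter>k. U k) = topspace ?T"
    using baire Uop Udense unfolding baire_space_def by blast
  moreover have "(\<Inter>k. U k) = {}"
  proof -
    \<comment> \<open>The index lies past the last one where h is nonzero; inserting 0 keeps
      \<open>Max\<close> meaningful when there is none.\<close>
    have "h \<notin> U (Suc (Max (insert 0 {n. h (p n) \<noteq> 0})))" if "h \<in> S" for h
      using that by (auto simp: U_def S_def Suc_le_eq)
    moreover have "(\<Inter>k. U k) \<subseteq> S"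
      unfolding U_def by blast
    ultimately show ?thesis
      by blast
  qed
  \<comment> \<open>The empty intersection has empty closure, whereas density would make it all of
    S, which contains the zero function.\<close>
  ultimately have "topspace ?T = {}"
    by simp
  moreover have "(\<lambda>x\<in>topspace X. 0) \<in> S"
    using C_ideal_zero pX by (simp add: S_def)
  ultimately show False
    using SC by (auto simp: topspace_m_topology [OF I])
qed

end

lemma q_point_imp_I_pseudocompact:
  assumes I: "ideal I (C_ring X)" and q: "q_point (m_topology X I) (\<lambda>x\<in>topspace X. 0)"
  shows "I_pseudocompact X I"
proof (rule ccontr)
  assume "\<not> I_pseudocompact X I"
  then obtain f p where f: "continuous_map X euclideanreal f"
    and p: "\<And>n. p n \<in> topspace X - (\<Inter>g\<in>I. zero_set X g)" and fp: "\<And>n::nat. real n \<le> \<bar>f (p n)\<bar>"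
    using not_I_pseudocompact_sequence [OF I] by blast
  have pX: "p n \<in> topspace X" for n
    using p by blast
  let ?M = "m_topology X I" and ?C = "carrier (C_ring X)" and ?z = "\<lambda>x\<in>topspace X. 0::real"
  obtain U where U: "\<forall>n::nat. openin ?M (U n) \<and> ?z \<in> U n"
    and cl: "\<forall>s. (\<forall>n. s n \<in> U n) \<longrightarrow>
       (\<exists>x\<in>topspace ?M. \<forall>V. openin ?M V \<and> x \<in> V \<longrightarrow> (\<exists>\<^sub>F n in sequentially. s n \<in> V))"
    using q unfolding q_point_def by (elim exE conjE) (rule that)
  \<comment> \<open>The bound \<open>inverse (real (Suc n))\<close> forces every cluster point to be
    zero; positivity at \<open>p n\<close> later provides a neighbourhood of zero that excludes all
    \<open>h n\<close>.\<close>
  have "\<exists>h. h \<in> I \<and> h \<in> U n \<and> (\<forall>x\<in>topspace X. 0 \<le> h x \<and> h x < inverse (real (Suc n))) \<and> 0 < h (p n)" for n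
  proof -
    obtain u where u: "u \<in> C_pos X" "B_m X ?z I u \<subseteq> U n"
      using U [rule_format, of n] unfolding openin_m_topology_iff [OF I] by blast
    have cu: "continuous_map X euclideanreal u" and pu: "\<And>x. x \<in> topspace X \<Longrightarrow> 0 < u x"
      using u by (auto simp: C_pos_def carrier_C_ring_iff)
    have "(\<lambda>x\<in>topspace X. min (u x) (inverse (real (Suc n)))) \<in> C_pos X"
      using pu by (intro restrict_in_C_pos continuous_map_real_min cu) auto
    then obtain h where h: "h \<in> I" "0 < h (p n)"
      and hu: "\<And>x. x \<in> topspace X \<Longrightarrow> 0 \<le> h x \<and> h x < (\<lambda>x\<in>topspace X. min (u x) (inverse (real (Suc n)))) x"
      using C_ideal_bump [OF I p] by blast
    have "h \<in> B_m X ?z I u"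
      unfolding B_m_def
    proof (intro CollectI conjI ballI C_ideal_carrier [OF I] h C_ideal_diff [OF I] C_ideal_zero [OF I])
      fix x assume "x \<in> topspace X"
      then show "\<bar>?z x - h x\<bar> < u x"
        using hu [of x] by simp
    qed
    then show ?thesis
      using u h hu by (intro exI [of _ h]) auto
  qed
  then obtain h where hI: "\<And>n. h n \<in> I" and hU: "\<And>n. h n \<in> U n"
    and hx: "\<And>n x. x \<in> topspace X \<Longrightarrow> 0 \<le> h n x \<and> h n x < inverse (real (Suc n))"
    and hp: "\<And>n. 0 < h n (p n)"
    by metis
  obtain y where y: "y \<in> topspace ?M"
    and cly: "\<And>V. openin ?M V \<Longrightarrow> y \<in> V \<Longrightarrow> \<exists>\<^sub>F n in sequentially. h n \<in> V"
    using cl [rule_format, of h] hU by blast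
  have yC: "y \<in> ?C"
    using y by (simp add: topspace_m_topology [OF I])
  have ball: "\<exists>\<^sub>F n in sequentially. h n \<in> B_m X y I u" if "u \<in> C_pos X" for u
    using that by (intro cly openin_B_m [OF I] B_m_self [OF I] yC)
  \<comment> \<open>Infinitely often \<open>h n\<close> comes within |y x| / 2 of y at x, while its
    own value there eventually drops below |y x| / 2.\<close>
  have y0: "y x = 0" if x: "x \<in> topspace X" for x
  proof (rule ccontr)
    assume "y x \<noteq> 0"
    let ?e = "\<bar>y x\<bar> / 2"
    have "?e > 0"
      using \<open>y x \<noteq> 0\<close> by simp
    then obtain m where m: "inverse (real (Suc m)) < ?e"
      using reals_Archimedean by blast
    have "(\<lambda>x\<in>topspace X. ?e) \<in> C_pos X"
      using \<open>?e > 0\<close> by (intro restrict_in_C_pos) auto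
    then obtain n where n: "n \<ge> m" "h n \<in> B_m X y I (\<lambda>x\<in>topspace X. ?e)"
      using ball unfolding frequently_sequentially by blast
    have "inverse (real (Suc n)) \<le> inverse (real (Suc m))"
      using n by (intro le_imp_inverse_le) auto
    moreover have "\<bar>y x - h n x\<bar> < ?e"
      using n x by (auto simp: B_m_def)
    ultimately show False
      using hx [OF x, of n] m by linarith
  qed
  \<comment> \<open>Since v(p n) \<le> h_n(p n) for every n and y vanishes on X, the ball of radius
    v about y contains no \<open>h n\<close>, contrary to clustering at y.\<close>
  obtain v where v: "v \<in> C_pos X"
    and vh: "\<And>x n. x \<in> topspace X \<Longrightarrow> real n \<le> \<bar>f x\<bar> \<Longrightarrow> v x \<le> h n (p n)"
    using C_pos_below [OF f, of "\<lambda>n. h n (p n)"] hp by blast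
  obtain n where "h n \<in> B_m X y I v"
    using ball [OF v] unfolding frequently_sequentially by blast
  then have "\<bar>h n (p n)\<bar> < v (p n)"
    using y0 [OF pX] pX [of n] by (auto simp: B_m_def)
  then show False
    using vh [OF pX fp, of n] by simp
qed

section \<open>The metric of uniform convergence on cosets\<close>

text \<open>The \<open>1\<close> caps the distance and is its value between different cosets of \<open>I\<close>. With an infimum
  in place of the supremum norm no boundedness of the functions in \<open>I\<close> is needed.\<close>

definition u_dist :: "'a topology \<Rightarrow> ('a \<Rightarrow> real) set \<Rightarrow> ('a \<Rightarrow> real) \<Rightarrow> ('a \<Rightarrow> real) \<Rightarrow> real"
  where "u_dist X I f g =
    Inf (insert 1 {e. 0 \<le> e \<and> (\<lambda>x\<in>topspace X. f x - g x) \<in> I \<and> (\<forall>x\<in>topspace X. \<bar>f x - g x\<bar> \<le> e)})"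

text \<open>This replaces the infimum by a witness. The alternative \<open>1 < r\<close> comes from
  the cap, so for r \<le> 1 a bound yields membership in the same coset.\<close>

lemma u_dist_less_iff:
  "u_dist X I f g < r \<longleftrightarrow> 1 < r \<or>
     (\<exists>e\<ge>0. e < r \<and> (\<lambda>x\<in>topspace X. f x - g x) \<in> I \<and> (\<forall>x\<in>topspace X. \<bar>f x - g x\<bar> \<le> e))"
  unfolding u_dist_def by (subst cInf_less_iff) (auto intro: bdd_belowI [of _ 0])

lemma u_dist_nonneg: "0 \<le> u_dist X I f g"
  unfolding u_dist_def by (rule cInf_greatest) auto

lemma Metric_space_u_dist:
  assumes I: "ideal I (C_ring X)"
  shows "Metric_space (carrier (C_ring X)) (u_dist X I)"
proof
  fix f g h :: "'a \<Rightarrow> real"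
  show "0 \<le> u_dist X I f g"
    by (rule u_dist_nonneg)
  show "u_dist X I f g = u_dist X I g f"
  proof -
    have "(\<lambda>x\<in>topspace X. f x - g x) \<in> I \<longleftrightarrow> (\<lambda>x\<in>topspace X. g x - f x) \<in> I"
      using C_ideal_minus [OF I] by blast
    then show ?thesis
      by (simp add: u_dist_def abs_minus_commute)
  qed
  assume f: "f \<in> carrier (C_ring X)" and g: "g \<in> carrier (C_ring X)"
  show "u_dist X I f g = 0 \<longleftrightarrow> f = g"
  proof
    assume 0: "u_dist X I f g = 0"
    have "f x = g x" if x: "x \<in> topspace X" for x
    proof (rule ccontr)
      assume "f x \<noteq> g x"
      \<comment> \<open>The minimum with 1 rules out the cap, so a uniform bound strictly below |f x
        - g x| would exist.\<close>
      then have "u_dist X I f g < min 1 \<bar>f x - g x\<bar>"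
        by (simp add: 0)
      then show False
        using x unfolding u_dist_less_iff by fastforce
    qed
    then show "f = g"
      using f g by (auto simp: carrier_C_ring_iff intro: extensionalityI)
  next
    assume "f = g"
    then have "u_dist X I f g < r" if "r > 0" for r
      unfolding u_dist_less_iff using that C_ideal_zero [OF I] by auto
    then show "u_dist X I f g = 0"
      using u_dist_nonneg [of X I f g] by (metis less_irrefl order_le_less)
  qed
  show "u_dist X I f h \<le> u_dist X I f g + u_dist X I g h"
  \<comment> \<open>Infima need not be attained, so the inequality is tested against each t above
    the sum, split as r + (t - r) with room on both sides.\<close>
  proof (rule dense_ge)
    fix t assume "u_dist X I f g + u_dist X I g h < t"
    then obtain r where r: "u_dist X I f g < r" "u_dist X I g h < t - r"
      by (metis add.commute less_diff_eq dense)
    show "u_dist X I f h \<le> t"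
    proof (cases "1 < t")
      case True
      then have "u_dist X I f h < t"
        by (simp add: u_dist_less_iff)
      then show ?thesis by simp
    next
      case False
      \<comment> \<open>Neither bound exceeds the cap, so both distances have witnesses; these add
        up.\<close>
      have "r \<le> 1" "t - r \<le> 1"
        using r False u_dist_nonneg [of X I f g] u_dist_nonneg [of X I g h] by linarith+
      then obtain e e' where e: "0 \<le> e" "e < r" "(\<lambda>x\<in>topspace X. f x - g x) \<in> I"
          "\<forall>x\<in>topspace X. \<bar>f x - g x\<bar> \<le> e"
        and e': "0 \<le> e'" "e' < t - r" "(\<lambda>x\<in>topspace X. g x - h x) \<in> I"
          "\<forall>x\<in>topspace X. \<bar>g x - h x\<bar> \<le> e'"
        using r unfolding u_dist_less_iff by (meson not_less)
      have "\<forall>x\<in>topspace X. \<bar>f x - h x\<bar> \<le> e + e'"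
        using e(4) e'(4) by (smt (verit))
      then have "u_dist X I f h < t"
        unfolding u_dist_less_iff using e e' C_ideal_diff_trans [OF I e(3) e'(3)]
        by (intro disjI2 exI [of _ "e + e'"]) auto
      then show ?thesis by simp
    qed
  qed
qed

text \<open>A Cauchy sequence eventually stays in one coset of I and converges uniformly to a
  continuous g. Uniform closedness of I puts g in the same coset, so the convergence holds for
  \<open>u_dist\<close> too.\<close>

lemma mcomplete_u_dist:
  assumes I: "ideal I (C_ring X)" and cl: "closed_under_uniform_limits X I"
  shows "Metric_space.mcomplete (carrier (C_ring X)) (u_dist X I)"
proof -
  interpret Metric_space "carrier (C_ring X)" "u_dist X I"
    by (rule Metric_space_u_dist [OF I])
  show ?thesis
    unfolding mcomplete_def
  proof (intro allI impI)
    fix \<sigma> assume \<sigma>: "MCauchy \<sigma>"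
    then have \<sigma>C: "\<And>n. \<sigma> n \<in> carrier (C_ring X)"
      and Cau: "\<And>e. e > 0 \<Longrightarrow> \<exists>N. \<forall>n n'. N \<le> n \<longrightarrow> N \<le> n' \<longrightarrow> u_dist X I (\<sigma> n) (\<sigma> n') < e"
      unfolding MCauchy_def by auto
    obtain N where N: "\<And>n n'. N \<le> n \<Longrightarrow> N \<le> n' \<Longrightarrow> (\<lambda>x\<in>topspace X. \<sigma> n x - \<sigma> n' x) \<in> I"
      using Cau [of 1] unfolding u_dist_less_iff by auto
    have unif: "\<exists>K. \<forall>m n x. K \<le> m \<longrightarrow> K \<le> n \<longrightarrow> x \<in> topspace X \<longrightarrow> dist (\<sigma> m x) (\<sigma> n x) < e"
      if "e > 0" for e
    proof -
      obtain K where K: "\<And>m n. K \<le> m \<Longrightarrow> K \<le> n \<Longrightarrow> u_dist X I (\<sigma> m) (\<sigma> n) < min 1 e"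
        using Cau [of "min 1 e"] \<open>e > 0\<close> by auto
      have "dist (\<sigma> m x) (\<sigma> n x) < e" if "K \<le> m" "K \<le> n" "x \<in> topspace X" for m n x
        using K [OF that(1,2)] that(3) unfolding u_dist_less_iff dist_real_def by fastforce
      then show ?thesis
        by blast
    qed
    have "\<forall>\<^sub>F n in sequentially. continuous_map X Met_TC.mtopology (\<sigma> n)"
      using \<sigma>C by (simp add: carrier_C_ring_iff)
    then obtain g where g: "continuous_map X Met_TC.mtopology g"
      and lim: "\<And>e. 0 < e \<Longrightarrow> \<forall>\<^sub>F n in sequentially. \<forall>x\<in>topspace X. dist (\<sigma> n x) (g x) < e"
      using Met_TC.continuous_map_uniformly_Cauchy_limit
        [OF mcomplete_iff_complete [THEN iffD2, OF complete_UNIV] _ unif] by blast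
    let ?g = "\<lambda>x\<in>topspace X. g x"
    have gcont: "continuous_map X euclideanreal g"
      using g by simp
    have gC: "?g \<in> carrier (C_ring X)"
      using gcont by (rule restrict_in_C_ring)
    \<comment> \<open>The shift by N puts every term in I, as
      \<open>closed_under_uniform_limits\<close> requires.\<close>
    define s where "s = (\<lambda>n. \<lambda>x\<in>topspace X. \<sigma> (n + N) x - \<sigma> N x)"
    define k where "k = (\<lambda>x\<in>topspace X. g x - \<sigma> N x)"
    have "uniform_limit (topspace X) s k sequentially"
      unfolding uniform_limit_iff
    proof (intro allI impI)
      fix e :: real assume "e > 0"
      then have "\<forall>\<^sub>F n in sequentially. \<forall>x\<in>topspace X. dist (\<sigma> (n + N) x) (g x) < e"
        using sequentially_offset [OF lim, of e N] by simp
      then show "\<forall>\<^sub>F n in sequentially. \<forall>x\<in>topspace X. dist (s n x) (k x) < e"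
        by eventually_elim (simp add: dist_real_def s_def k_def)
    qed
    moreover have "k \<in> carrier (C_ring X)"
      unfolding k_def using gcont \<sigma>C
      by (intro restrict_in_C_ring continuous_map_diff) (auto simp: carrier_C_ring_iff)
    moreover have "\<forall>n. s n \<in> I"
      using N by (simp add: s_def)
    ultimately have "k \<in> I"
      using cl unfolding closed_under_uniform_limits_def by blast
    then have "(\<lambda>x\<in>topspace X. g x - \<sigma> N x) \<in> I"
      by (simp add: k_def)
    \<comment> \<open>Decompose the difference as (\<sigma> n - \<sigma> N) + (\<sigma> N -
      g).\<close>
    then have gI: "(\<lambda>x\<in>topspace X. \<sigma> n x - ?g x) \<in> I" if "N \<le> n" for n
      using C_ideal_diff_trans [OF I N [OF that order_refl] C_ideal_minus [OF I]]
      by (simp cong: restrict_cong)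
    have "limitin mtopology \<sigma> ?g sequentially"
      unfolding limitin_metric
    proof (intro conjI gC allI impI)
      fix e :: real assume "e > 0"
      \<comment> \<open>Half of e leaves a uniform bound strictly below e, as
        \<open>u_dist_less_iff\<close> demands.\<close>
      then have "\<forall>\<^sub>F n in sequentially. \<forall>x\<in>topspace X. dist (\<sigma> n x) (g x) < e / 2"
        by (intro lim) simp
      then show "\<forall>\<^sub>F n in sequentially. \<sigma> n \<in> carrier (C_ring X) \<and> u_dist X I (\<sigma> n) ?g < e"
        using eventually_ge_at_top [of N]
      proof eventually_elim
        case (elim n)
        then show ?case
          unfolding u_dist_less_iff using gI \<sigma>C \<open>e > 0\<close>
          by (intro conjI disjI2 exI [of _ "e / 2"]) (auto simp: dist_real_def less_imp_le)
      qed
    qed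
    then show "\<exists>x. limitin mtopology \<sigma> x sequentially"
      by blast
  qed
qed

text \<open>Constant radius functions give one inclusion. For the other, 1/u is bounded on
  \<open>?Y\<close>, so u is bounded away from 0 there; off \<open>?Y\<close> all members of I
  vanish and the condition |f - g| < u is automatic.\<close>

lemma m_topology_eq_mtopology_u_dist:
  assumes I: "ideal I (C_ring X)" and pc: "I_pseudocompact X I"
  shows "m_topology X I = Metric_space.mtopology (carrier (C_ring X)) (u_dist X I)"
proof -
  interpret Metric_space "carrier (C_ring X)" "u_dist X I"
    by (rule Metric_space_u_dist [OF I])
  let ?Y = "topspace X - (\<Inter>g\<in>I. zero_set X g)"
  have to_ball: "\<exists>u\<in>C_pos X. B_m X f I u \<subseteq> mball f r" if f: "f \<in> carrier (C_ring X)" and "r > 0" for f r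
  proof
    show "(\<lambda>x\<in>topspace X. r / 2) \<in> C_pos X"
      using \<open>r > 0\<close> by (intro restrict_in_C_pos) auto
    show "B_m X f I (\<lambda>x\<in>topspace X. r / 2) \<subseteq> mball f r"
    proof
      fix g assume g: "g \<in> B_m X f I (\<lambda>x\<in>topspace X. r / 2)"
      then have "u_dist X I f g < r"
        unfolding u_dist_less_iff using \<open>r > 0\<close>
        by (intro disjI2 exI [of _ "r / 2"]) (auto simp: B_m_def less_imp_le)
      then show "g \<in> mball f r"
        using f g by (simp add: B_m_def)
    qed
  qed
  have from_ball: "\<exists>r>0. mball f r \<subseteq> B_m X f I u" if u: "u \<in> C_pos X" for f u
  proof -
    have "continuous_map X euclideanreal u" and upos: "\<And>x. x \<in> topspace X \<Longrightarrow> 0 < u x"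
      using u by (auto simp: C_pos_def carrier_C_ring_iff)
    then have "(\<lambda>x\<in>topspace X. inverse (u x)) \<in> carrier (C_ring X)"
      by (intro restrict_in_C_ring continuous_map_real_inverse) (auto simp: less_imp_neq [THEN not_sym])
    then have "bounded ((\<lambda>x\<in>topspace X. inverse (u x)) ` ?Y)"
      using pc unfolding I_pseudocompact_def bounded_subset_def by blast
    then obtain b where "b > 0" and b: "\<And>x. x \<in> ?Y \<Longrightarrow> inverse (u x) \<le> b"
      unfolding bounded_pos by (force simp: abs_le_iff)
    have below: "inverse b \<le> u x" if "x \<in> ?Y" for x
      using b [OF that] upos [of x] that by (metis DiffD1 inverse_inverse_eq inverse_positive_iff_positive le_imp_inverse_le)
    \<comment> \<open>The 1 keeps the ball in the coset of f; \<open>inverse b\<close> is a lower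
      bound of u on \<open>?Y\<close>.\<close>
    have "mball f (min 1 (inverse b)) \<subseteq> B_m X f I u"
    proof
      fix g assume g: "g \<in> mball f (min 1 (inverse b))"
      then have "u_dist X I f g < min 1 (inverse b)"
        by simp
      then obtain e where e: "e < min 1 (inverse b)" "\<forall>x\<in>topspace X. \<bar>f x - g x\<bar> \<le> e"
        and fg: "(\<lambda>x\<in>topspace X. f x - g x) \<in> I"
        unfolding u_dist_less_iff by auto
      have "\<bar>f x - g x\<bar> < u x" if x: "x \<in> topspace X" for x
      proof (cases "x \<in> ?Y")
        case True
        then show ?thesis
          using below e x by force
      next
        case False
        then have "x \<in> zero_set X (\<lambda>x\<in>topspace X. f x - g x)"
          using fg x by blast
        then show ?thesis
          using x upos by (simp add: zero_set_def)
      qed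
      then show "g \<in> B_m X f I u"
        using g fg by (simp add: B_m_def)
    qed
    then show ?thesis
      using \<open>b > 0\<close> by (intro exI [of _ "min 1 (inverse b)"]) auto
  qed
  show ?thesis
    unfolding topology_eq openin_m_topology_iff [OF I] openin_mtopology
    using to_ball from_ball by (meson subset_eq subset_trans)
qed

lemma I_pseudocompact_imp_completely_metrizable:
  assumes "ideal I (C_ring X)" "closed_under_uniform_limits X I" "I_pseudocompact X I"
  shows "completely_metrizable_space (m_topology X I)"
  unfolding completely_metrizable_space_def
  using Metric_space_u_dist mcomplete_u_dist m_topology_eq_mtopology_u_dist assms by blast

section \<open>The equivalences\<close>

text \<open>Z itself serves as the source, copied into the sum type along \<open>Inl\<close>; the
  projection back is a homeomorphism. Paracompactness comes from metrizability.\<close>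

lemma completely_metrizable_imp_open_continuous_image:
  fixes Z :: "'a topology"
  assumes Z: "completely_metrizable_space Z"
  obtains Y :: "('a + 'b) topology" and q
  where "paracompact_space Y" "cech_complete_space Y" "open_continuous_image_via Y Z q"
proof -
  define Y :: "('a + 'b) topology" where "Y = pullback_topology (range Inl) projl Z"
  have Yop: "openin Y V \<longleftrightarrow> (\<exists>U. openin Z U \<and> V = Inl ` U)" for V
  proof -
    have "projl -` U \<inter> range Inl = (Inl ` U :: ('a + 'b) set)" for U
      by force
    then show ?thesis
      by (simp add: Y_def openin_pullback_topology)
  qed
  have Ytop: "topspace Y = Inl ` topspace Z"
    by (force simp: Y_def topspace_pullback_topology)
  have hom: "homeomorphic_map Y Z projl"
  proof (rule bijective_open_imp_homeomorphic_map)
    show "continuous_map Y Z projl"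
      unfolding continuous_map_def
    proof (intro conjI allI impI)
      fix U assume U: "openin Z U"
      then have "{x \<in> topspace Y. projl x \<in> U} = Inl ` U"
        using openin_subset [OF U] by (auto simp: Ytop)
      then show "openin Y {x \<in> topspace Y. projl x \<in> U}"
        using U Yop by blast
    qed (auto simp: Ytop)
    show "open_map Y Z projl"
      by (auto simp: open_map_def Yop image_image)
  qed (auto simp: Ytop image_image inj_on_def)
  then have Y: "completely_metrizable_space Y"
    using Z homeomorphic_completely_metrizable_space homeomorphic_map_imp_homeomorphic_space by blast
  show thesis
  proof
    show "paracompact_space Y"
      using Y by (intro metrizable_imp_paracompact_space completely_metrizable_imp_metrizable_space)
    show "cech_complete_space Y"
      using Y by (rule completely_metrizable_imp_cech_complete_space)
    show "open_continuous_image_via Y Z projl"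
      using hom by (simp add: open_continuous_image_via_def homeomorphic_eq_everything_map)
  qed
qed

lemma cech_complete_imp_locally_cech_complete_space:
  assumes "cech_complete_space Y"
  shows "locally_cech_complete_space Y"
  unfolding locally_cech_complete_space_def
proof (intro conjI ballI)
  show "tychonoff_space Y"
    using assms by (simp add: cech_complete_space_def)
  fix y assume "y \<in> topspace Y"
  then show "\<exists>U N. openin Y U \<and> y \<in> U \<and> U \<subseteq> N \<and> N \<subseteq> topspace Y \<and>
                   cech_complete_space (subtopology Y N)"
    using assms by (intro exI [of _ "topspace Y"]) simp
qed

theorem theorem8p4:
  fixes X :: "'a topology" and I :: "('a \<Rightarrow> real) set"
  assumes "tychonoff_space X"
    and "ideal I (C_ring X)"
    and "closed_under_uniform_limits X I"
  shows "(completely_metrizable_space (m_topology X I)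
            \<longleftrightarrow> cech_complete_space (m_topology X I))
       \<and> (completely_metrizable_space (m_topology X I)
            \<longleftrightarrow> hereditarily_baire_space (m_topology X I))
       \<and> (completely_metrizable_space (m_topology X I)
            \<longleftrightarrow> I_pseudocompact X I)
       \<and> (completely_metrizable_space (m_topology X I)
            \<longleftrightarrow> locally_cech_complete_space (m_topology X I))
       \<and> (completely_metrizable_space (m_topology X I)
            \<longleftrightarrow> (\<exists>(Y :: (('a \<Rightarrow> real) + 'b) topology) q.
                   paracompact_space Y \<and> cech_complete_space Y
                   \<and> open_continuous_image_via Y (m_topology X I) q))
       \<and> (completely_metrizable_space (m_topology X I)
            \<longleftrightarrow> (\<exists>(Y :: (('a \<Rightarrow> real) + 'b) topology) q.
                   cech_complete_space Y
                   \<and> open_continuous_image_via Y (m_topology X I) q))"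
    (is "(?cm \<longleftrightarrow> ?cc) \<and> (?cm \<longleftrightarrow> ?hb) \<and> (?cm \<longleftrightarrow> ?pc) \<and> (?cm \<longleftrightarrow> ?lcc) \<and> (?cm \<longleftrightarrow> ?pim) \<and> (?cm \<longleftrightarrow> ?im)")
proof -
  let ?M = "m_topology X I" and ?z = "\<lambda>x\<in>topspace X. 0::real"
  note I = assms(2)
  have z: "?z \<in> topspace ?M"
    by (simp add: topspace_m_topology [OF I] C_ideal_carrier [OF I] C_ideal_zero [OF I])
  \<comment> \<open>The implications close up through three cycles that share \<open>?pc\<close> and
    \<open>?cm\<close>: one via \<open>?cc\<close> and \<open>?lcc\<close>, one via
    \<open>?hb\<close>, and one via \<open>?pim\<close> and \<open>?im\<close>.\<close>
  have "?pc \<Longrightarrow> ?cm"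
    using assms by (intro I_pseudocompact_imp_completely_metrizable)
  moreover have "?cm \<Longrightarrow> ?cc"
    by (rule completely_metrizable_imp_cech_complete_space)
  moreover have "?cm \<Longrightarrow> ?hb"
    by (rule completely_metrizable_imp_hereditarily_baire_space)
  moreover have "?cc \<Longrightarrow> ?lcc"
    by (rule cech_complete_imp_locally_cech_complete_space)
  moreover have "?cm \<Longrightarrow> ?pim"
    using completely_metrizable_imp_open_continuous_image by metis
  moreover have "?pim \<Longrightarrow> ?im"
    by blast
  moreover have "?hb \<Longrightarrow> ?pc"
    by (rule hereditarily_baire_imp_I_pseudocompact [OF I])
  moreover have "?lcc \<Longrightarrow> ?pc"
    by (intro q_point_imp_I_pseudocompact [OF I] locally_cech_complete_imp_q_point z)
  moreover have "?im \<Longrightarrow> ?pc"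
  proof -
    assume ?im
    then obtain Y :: "(('a \<Rightarrow> real) + 'b) topology" and q
      where Y: "cech_complete_space Y" and q: "open_continuous_image_via Y ?M q"
      by blast
    then obtain y where y: "y \<in> topspace Y" "?z = q y"
      using z unfolding open_continuous_image_via_def by blast
    have "q_point ?M (q y)"
      by (intro q_point_open_continuous_image [OF q] cech_complete_imp_q_point Y y)
    then show ?pc
      using q_point_imp_I_pseudocompact [OF I] y by simp
  qed
  ultimately show ?thesis
    by argo
qed

end
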